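(* Let $(\alpha,\nu)$ be critical data with excess lifetime probability measure $\nu_e$. A measure $\xi\in\mathcal{M}_F^c$ is an invariant state (that is, $\bar\mu_\xi(t)=\xi$ for all $t\ge 0$) if and only if $\xi=c\,\nu_e$ for some $c\in[0,\infty)$. Equivalently, the invariant manifold $\mathfrak{I}=\{\xi\in\mathcal{M}_F^c:\bar\mu_\xi(t)=\xi\text{ for all }t\ge 0\}$ is given by $\mathfrak{I}=\{c\,\nu_e: c\in[0,\infty)\}$.
   Context: $\mathbb{R}_+=[0,\infty)$. $\mathcal{M}_F$ is the space of finite nonnegative Borel measures on $\mathbb{R}_+$ with the topology of weak convergence; $\langle g,\zeta\rangle=\int_{\mathbb{R}_+}g\,d\zeta$; $\mathbb{1}_A$ is the indicator of $A$, $\mathbb{1}=\mathbb{1}_{\mathbb{R}_+}$, and $\chi(x)=x$. $\mathcal{M}_F^c$ is the set of $\xi\in\mathcal{M}_F$ with $\langle\mathbb{1}_{\{x\}},\xi\rangle=0$ for all $x\in\mathbb{R}_+$ (no atoms). Critical data $(\alpha,\nu)$: $\nu$ is a Borel probability measure on $\mathbb{R}_+$ with $\nu(\{0\})=0$ and $\langle\chi,\nu\rangle<\infty$, and $\alpha=1/\langle\chi,\nu\rangle$. $F$ is the cumulative distribution function of $\nu$. The excess lifetime probability measure $\nu_e$ is the Borel probability measure on $\mathbb{R}_+$ with density $f_e(x)=\alpha(1-F(x))$, $x\in\mathbb{R}_+$. Let $\mathcal{C}=\{g\in \mathbf{C}_b^1(\mathbb{R}_+): g(0)=0,\ g'(0)=0\}$,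 where $\mathbf{C}^1_b(\mathbb{R}_+)$ is the set of once continuously differentiable real functions on $\mathbb{R}_+$ that are bounded together with their first derivatives. A fluid model solution (for $(\alpha,\nu)$) is a function $\bar\mu:[0,\infty)\to\mathcal{M}_F$ such that: (C1) $\bar\mu(\cdot)$ is continuous; (C2) $\langle\mathbb{1}_{\{0\}},\bar\mu(t)\rangle=0$ for each $t\ge0$; (C3) for each $g\in\mathcal{C}$, $\langle g,\bar\mu(t)\rangle=\langle g,\bar\mu(0)\rangle-\int_0^t\frac{\langle g',\bar\mu(s)\rangle}{\langle\mathbb{1},\bar\mu(s)\rangle}\,ds+\alpha t\langle g,\nu\rangle$ for all $0\le t<t^*$, where $t^*=\inf\{s\ge0:\langle\mathbb{1},\bar\mu(s)\rangle=0\}$; (C4) $\langle\mathbb{1},\bar\mu(t)\rangle=0$ for all $t\ge t^*$. It is known (from earlier work) that for each $\xi\in\mathcal{M}_F^c$ there is a unique fluid model solution $\bar\mu_\xi(\cdot)$ with $\bar\mu_\xi(0)=\xi$; also $\bar\mu_\xi(t)\in\mathcal{M}_F^c$ for all $t$, $\bar\mu_\xi(t)\ne\mathbf{0}$ for all $t$ (so $t^*=\infty$) if $\xi\neq\mathbf{0}$, and $\bar\mu_{\mathbf{0}}(\cdot)\equiv\mathbf{0}$, where $\mathbf{0}$ is the zero measure. *)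

theory Defs
  imports "HOL-Probability.Probability"
begin

text \<open>Measures on \<open>[0, \<infinity>)\<close> are measures whose space is the half-line itself. In particular a set such
  as \<open>{..x}\<close> is not measurable for them, so the library constant \<^const>\<open>cdf\<close> does not apply.\<close>

abbreviation borel_Rp :: "real measure" where
  "borel_Rp \<equiv> restrict_space borel {0..}"

definition MF :: "real measure set" where
  "MF = {\<zeta>. sets \<zeta> = sets borel_Rp \<and> finite_measure \<zeta>}"

definition MFc :: "real measure set" where
  "MFc = {\<xi> \<in> MF. \<forall>x\<ge>0. measure \<xi> {x} = 0}"

definition pairing :: "(real \<Rightarrow> real) \<Rightarrow> real measure \<Rightarrow> real" where
  "pairing g \<zeta> = (\<integral>x. g x \<partial>\<zeta>)"

definition mass :: "real measure \<Rightarrow> real" where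
  "mass \<zeta> = pairing (\<lambda>_. 1) \<zeta>"

text \<open>The coarsest topology on \<^const>\<open>MF\<close> making all pairings with bounded continuous functions on
  \<open>[0, \<infinity>)\<close> continuous.\<close>

definition weak_topology :: "real measure topology" where
  "weak_topology = topology_generated_by
     {{\<zeta> \<in> MF. pairing f \<zeta> \<in> U} | f U.
        continuous_on {0..} f \<and> bounded (f ` {0..}) \<and> open U}"

definition critical_data :: "real \<Rightarrow> real measure \<Rightarrow> bool" where
  "critical_data \<alpha> \<nu> \<longleftrightarrow>
     sets \<nu> = sets borel_Rp \<and> prob_space \<nu> \<and> measure \<nu> {0} = 0 \<and>
     integrable \<nu> (\<lambda>x. x) \<and> \<alpha> = 1 / pairing (\<lambda>x. x) \<nu>"

definition dist_fun :: "real measure \<Rightarrow> real \<Rightarrow> real" where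
  "dist_fun \<nu> x = measure \<nu> {0..x}"

definition excess_lifetime :: "real \<Rightarrow> real measure \<Rightarrow> real measure" where
  "excess_lifetime \<alpha> \<nu> =
     density (restrict_space lborel {0..}) (\<lambda>x. ennreal (\<alpha> * (1 - dist_fun \<nu> x)))"

text \<open>\<open>C1b g g'\<close>: \<open>g\<close> is in \<open>C\<^sub>b\<^sup>1\<close> of the half-line and \<open>g'\<close> is its derivative there (one-sided
  at \<open>0\<close>). Values at negative arguments play no role.\<close>

definition C1b :: "(real \<Rightarrow> real) \<Rightarrow> (real \<Rightarrow> real) \<Rightarrow> bool" where
  "C1b g g' \<longleftrightarrow>
     (\<forall>x\<ge>0. (g has_real_derivative g' x) (at x within {0..})) \<and>
     continuous_on {0..} g' \<and> bounded (g ` {0..}) \<and> bounded (g' ` {0..})"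

text \<open>The infimum is \<open>\<infinity>\<close> if the mass never vanishes.\<close>

definition t_star :: "(real \<Rightarrow> real measure) \<Rightarrow> ereal" where
  "t_star \<mu> = Inf (ereal ` {s. 0 \<le> s \<and> mass (\<mu> s) = 0})"

definition fluid_model_solution :: "real \<Rightarrow> real measure \<Rightarrow> (real \<Rightarrow> real measure) \<Rightarrow> bool" where
  "fluid_model_solution \<alpha> \<nu> \<mu> \<longleftrightarrow>
     (\<forall>t\<ge>0. \<mu> t \<in> MF) \<and>
     continuous_map (top_of_set {0..}) weak_topology \<mu> \<and>
     (\<forall>t\<ge>0. measure (\<mu> t) {0} = 0) \<and>
     (\<forall>g g'. C1b g g' \<and> g 0 = 0 \<and> g' 0 = 0 \<longrightarrow>
        (\<forall>t. 0 \<le> t \<and> ereal t < t_star \<mu> \<longrightarrow>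
           pairing g (\<mu> t) = pairing g (\<mu> 0)
             - integral {0..t} (\<lambda>s. pairing g' (\<mu> s) / mass (\<mu> s))
             + \<alpha> * t * pairing g \<nu>)) \<and>
     (\<forall>t\<ge>0. t_star \<mu> \<le> ereal t \<longrightarrow> mass (\<mu> t) = 0)"

text \<open>\<open>\<mu>\<close> is the unique fluid model solution with initial state \<open>\<xi>\<close>. Only times \<open>t \<ge> 0\<close> matter, so
  uniqueness is equality on \<open>[0, \<infinity>)\<close>.\<close>

definition the_fluid_model_solution ::
    "real \<Rightarrow> real measure \<Rightarrow> real measure \<Rightarrow> (real \<Rightarrow> real measure) \<Rightarrow> bool" where
  "the_fluid_model_solution \<alpha> \<nu> \<xi> \<mu> \<longleftrightarrow>
     fluid_model_solution \<alpha> \<nu> \<mu> \<and> \<mu> 0 = \<xi> \<and>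
     (\<forall>\<mu>'. fluid_model_solution \<alpha> \<nu> \<mu>' \<and> \<mu>' 0 = \<xi> \<longrightarrow> (\<forall>t\<ge>0. \<mu>' t = \<mu> t))"

definition invariant_state :: "real \<Rightarrow> real measure \<Rightarrow> real measure \<Rightarrow> bool" where
  "invariant_state \<alpha> \<nu> \<xi> \<longleftrightarrow>
     (\<exists>\<mu>. the_fluid_model_solution \<alpha> \<nu> \<xi> \<mu> \<and> (\<forall>t\<ge>0. \<mu> t = \<xi>))"

definition invariant_manifold :: "real \<Rightarrow> real measure \<Rightarrow> real measure set" where
  "invariant_manifold \<alpha> \<nu> = {\<xi> \<in> MFc. invariant_state \<alpha> \<nu> \<xi>}"

end

theory Submission
  imports Defs
begin

text \<open>For \<open>g(0) = 0\<close>, Fubini gives \<open>\<langle>g', \<nu>\<^sub>e\<rangle> = \<alpha> \<langle>g, \<nu>\<rangle>\<close>. If \<open>\<xi>\<close> is invariant with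
  mass \<open>z > 0\<close>, the fluid equation therefore says that \<open>\<xi> - z \<nu>\<^sub>e\<close> annihilates every \<open>g'\<close>. For the
  translates of a smooth step \<open>h\<close> this means that \<open>\<langle>h(\<cdot> - p), \<xi> - z \<nu>\<^sub>e\<rangle>\<close> does not depend on
  \<open>p \<ge> 0\<close>; it vanishes as \<open>p \<rightarrow> \<infinity>\<close>, so \<open>\<xi> = z \<nu>\<^sub>e\<close>.

  Conversely \<open>c \<nu>\<^sub>e\<close> is a constant solution, and it remains to see that it is the only solution \<open>\<mu>\<close>
  started there. With \<open>S(t) = \<integral>\<^sub>0\<^sup>t 1/z(s) ds\<close>, where \<open>z\<close> is the mass of \<open>\<mu>\<close>, the
  functions \<open>g\<^sub>t = h(\<cdot> - w + S(t))\<close> satisfy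
  \<open>d/dt \<langle>g\<^sub>t, \<mu>(t) - c \<nu>\<^sub>e\<rangle> = \<alpha> \<langle>g\<^sub>t, \<nu>\<rangle> (1 - c / z(t))\<close>. Letting \<open>h\<close> increase to the
  indicator of \<open>(0, \<infinity>)\<close> gives \<open>\<bar>z(t) - c\<bar> \<le> \<integral>\<^sub>0\<^sup>t \<alpha> \<bar>z(s) - c\<bar> / z(s) ds\<close>, hence
  \<open>z = c\<close> by Gronwall, and then the tests by \<open>h\<close> identify \<open>\<mu>(t)\<close> with \<open>c \<nu>\<^sub>e\<close>.\<close>

section \<open>Smooth steps\<close>

lemma has_real_derivative_pos_part_square:
  "((\<lambda>x. (max 0 x)\<^sup>2) has_real_derivative 2 * max 0 x) (at (x::real))"
proof -
  consider "x > 0" | "x < 0" | "x = 0" by linarith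
  then show ?thesis
  proof cases
    case 1
    have "((\<lambda>x. x\<^sup>2) has_real_derivative 2 * max 0 x) (at x)"
      using 1 by (auto intro!: derivative_eq_intros)
    then show ?thesis
      by (rule has_field_derivative_transform_within_open[where S="{0<..}"]) (use 1 in auto)
  next
    case 2
    have "((\<lambda>x. 0) has_real_derivative 2 * max 0 x) (at x)"
      using 2 by auto
    then show ?thesis
      by (rule has_field_derivative_transform_within_open[where S="{..<0}"]) (use 2 in auto)
  next
    case 3
    \<comment> \<open>Where the two branches meet, the difference quotient is \<open>h\<close> or 0
      and hence dominated by the absolute value of \<open>h\<close>.\<close>
    have "((\<lambda>h. (max 0 h)\<^sup>2 / h) \<longlongrightarrow> 0) (at (0::real))"
    proof (rule Lim_null_comparison)
      show "\<forall>\<^sub>F h in at 0. norm ((max 0 h)\<^sup>2 / h) \<le> \<bar>h::real\<bar>"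
        by (auto simp: eventually_at_filter max_def power2_eq_square)
      show "((\<lambda>h::real. \<bar>h\<bar>) \<longlongrightarrow> 0) (at 0)"
        by (intro tendsto_eq_intros) auto
    qed
    then show ?thesis
      using 3 by (simp add: DERIV_def)
  qed
qed

text \<open>For k > 0 a rational cutoff rising from 0 to 1. Squaring the positive part makes value
  and derivative vanish on the nonpositive axis, so that translation by p >= 0 gives tests with g(0)
  = g'(0) = 0. For large \<open>k\<close> the step sharpens to the indicator of (0,
  infinity).\<close>

definition ramp :: "real \<Rightarrow> real \<Rightarrow> real" where
  "ramp k x = k * (max 0 x)\<^sup>2 / (1 + k * (max 0 x)\<^sup>2)"

definition ramp' :: "real \<Rightarrow> real \<Rightarrow> real" where
  "ramp' k x = 2 * k * max 0 x / (1 + k * (max 0 x)\<^sup>2)\<^sup>2"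

lemma ramp_derivative:
  assumes "k \<ge> 0"
  shows "(ramp k has_real_derivative ramp' k x) (at x)"
proof -
  have "1 + k * (max 0 x)\<^sup>2 > 0" for x :: real
    using assms by (intro add_pos_nonneg) auto
  then have nz: "1 + k * (max 0 x)\<^sup>2 \<noteq> 0" for x :: real
    by (metis less_irrefl)
  show ?thesis
    unfolding ramp_def[abs_def] ramp'_def
    by (rule derivative_eq_intros has_real_derivative_pos_part_square refl nz)+
       (use nz[of x] in \<open>simp add: field_simps power2_eq_square\<close>)
qed

text \<open>With \<open>p\<close> the positive part of \<open>x\<close>, 2p <= 1 + p^2 <= 1 + k p^2,
  and the last term is at most its own square; the denominator thus absorbs
  \<open>p\<close>.\<close>

lemma ramp'_bound:
  assumes "k \<ge> 1"
  shows "\<bar>ramp' k x\<bar> \<le> 2 * k"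
proof -
  define p where "p = max 0 x"
  have p: "p \<ge> 0" by (simp add: p_def)
  have "2 * p \<le> 1 + p\<^sup>2"
    using sum_squares_bound[of 1 p] by simp
  moreover have "p\<^sup>2 \<le> k * p\<^sup>2"
    using assms mult_right_mono[of 1 k "p\<^sup>2"] by simp
  ultimately have 1: "p \<le> 1 + k * p\<^sup>2"
    using p by linarith
  have 2: "1 \<le> 1 + k * p\<^sup>2"
    using assms by simp
  have "p \<le> (1 + k * p\<^sup>2)\<^sup>2"
    using 1 2 mult_mono[of p "1 + k * p\<^sup>2" 1 "1 + k * p\<^sup>2"] p by (simp add: power2_eq_square)
  then have "2 * k * p / (1 + k * p\<^sup>2)\<^sup>2 \<le> 2 * k"
    using 2 assms by (subst divide_le_eq) (auto intro!: mult_left_mono)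
  moreover have "0 \<le> 2 * k * p / (1 + k * p\<^sup>2)\<^sup>2"
    using p assms by simp
  ultimately show ?thesis
    by (simp add: ramp'_def p_def)
qed

text \<open>\<open>ramp' k\<close> has a corner at 0, so the mean value inequality is applied to the
  rational function \<open>u\<close>, smooth on the whole line, which is then composed with the
  1-Lipschitz map \<open>max 0\<close>. With q = 1 + k p^2, the factor 1 - 3 k p^2 in
  \<open>u'\<close> is at most 3 q <= 3 q^3 in absolute value, which yields the constant 6k.\<close>

lemma ramp'_Lipschitz:
  assumes "k \<ge> 1"
  shows "\<bar>ramp' k x - ramp' k y\<bar> \<le> 6 * k * \<bar>x - y\<bar>"
proof -
  define u where "u p = 2 * k * p / (1 + k * p\<^sup>2)\<^sup>2" for p
  define u' where "u' p = 2 * k * (1 - 3 * k * p\<^sup>2) / (1 + k * p\<^sup>2) ^ 3" for p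
  have pos: "1 + k * p\<^sup>2 \<ge> 1" for p
    using assms by simp
  have nz: "1 + k * p\<^sup>2 \<noteq> 0" for p
    using pos[of p] by linarith
  have "(u has_field_derivative u' p) (at p)" for p
  proof -
    define q where "q = 1 + k * p\<^sup>2"
    have q: "q \<noteq> 0" "1 + k * p\<^sup>2 = q" "k * p\<^sup>2 = q - 1"
      using nz by (auto simp: q_def)
    have "(u has_field_derivative
       (2 * k * q\<^sup>2 - 2 * k * p * (2 * q * (k * (2 * p)))) / (q\<^sup>2 * q\<^sup>2)) (at p)"
      unfolding u_def[abs_def] q_def
      by (rule derivative_eq_intros refl)+ (use nz in \<open>auto simp: power2_eq_square\<close>)
    also have "(2 * k * q\<^sup>2 - 2 * k * p * (2 * q * (k * (2 * p)))) = 2 * k * q * (q - 4 * (k * p\<^sup>2))"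
      by (simp add: algebra_simps power2_eq_square)
    also have "\<dots> / (q\<^sup>2 * q\<^sup>2) = u' p"
      using q(1) unfolding u'_def mult.assoc[of 3] mult.assoc[of 3 k] q(2,3)
      by (simp add: field_simps power2_eq_square power3_eq_cube)
    finally show ?thesis .
  qed
  moreover have "norm (u' p) \<le> 6 * k" for p
  proof -
    define q where "q = 1 + k * p\<^sup>2"
    have q: "q \<ge> 1" using pos by (simp add: q_def)
    have "\<bar>1 - 3 * k * p\<^sup>2\<bar> \<le> 3 * q"
      using assms by (simp add: q_def abs_le_iff)
    also have "\<dots> \<le> 3 * q ^ 3"
      using power_increasing[of 1 3 q] q by simp
    finally have "2 * k * \<bar>1 - 3 * k * p\<^sup>2\<bar> \<le> 2 * k * (3 * q ^ 3)"
      using assms by (intro mult_left_mono) auto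
    then have "2 * k * \<bar>1 - 3 * k * p\<^sup>2\<bar> / q ^ 3 \<le> 6 * k"
      using q by (simp add: divide_le_eq)
    moreover have "norm (u' p) = 2 * k * \<bar>1 - 3 * k * p\<^sup>2\<bar> / q ^ 3"
      using q assms by (simp add: u'_def q_def abs_mult)
    ultimately show ?thesis by simp
  qed
  ultimately have "norm (u (max 0 x) - u (max 0 y)) \<le> 6 * k * norm (max 0 x - max 0 y)"
    by (intro field_differentiable_bound[of UNIV u u']) auto
  also have "\<dots> \<le> 6 * k * \<bar>x - y\<bar>"
    using assms by (intro mult_left_mono) auto
  finally show ?thesis
    by (simp add: u_def ramp'_def)
qed

lemma ramp_continuous:
  assumes "k \<ge> 0"
  shows "continuous_on S (\<lambda>x. ramp k (x - p))"
proof (rule continuous_on_compose2[of UNIV "ramp k" S "\<lambda>x. x - p"])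
  show "continuous_on UNIV (ramp k)"
    using DERIV_isCont[OF ramp_derivative[OF assms]] by (simp add: continuous_at_imp_continuous_on)
  show "continuous_on S (\<lambda>x. x - p)"
    by (intro continuous_intros)
qed simp

lemma ramp'_continuous:
  assumes "k \<ge> 0"
  shows "continuous_on S (\<lambda>x. ramp' k (x - p))"
proof -
  have "1 + k * (max 0 y)\<^sup>2 > 0" for y :: real
    using assms by (intro add_pos_nonneg) auto
  then have "1 + k * (max 0 y)\<^sup>2 \<noteq> 0" for y :: real
    by (metis less_irrefl)
  then show ?thesis
    unfolding ramp'_def by (intro continuous_intros) auto
qed

text \<open>Mean value inequality for \<open>\<phi>\<close>, whose derivative
  \<open>ramp' k y - ramp' k x\<close> is at most 6 k |d| on the segment by the Lipschitz bound. A
  remainder uniform in \<open>x\<close> can be integrated against any finite measure.\<close>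

lemma ramp_Taylor:
  assumes "k \<ge> 1"
  shows "\<bar>ramp k (x + d) - ramp k x - d * ramp' k x\<bar> \<le> 6 * k * d\<^sup>2"
proof -
  define \<phi> where "\<phi> y = ramp k y - y * ramp' k x" for y
  have "norm (\<phi> (x + d) - \<phi> x) \<le> 6 * k * \<bar>d\<bar> * norm (x + d - x)"
  proof (rule field_differentiable_bound[where S="closed_segment x (x + d)"])
    fix y assume y: "y \<in> closed_segment x (x + d)"
    show "(\<phi> has_field_derivative ramp' k y - ramp' k x) (at y within closed_segment x (x + d))"
      unfolding \<phi>_def[abs_def] using assms
      by (auto intro!: derivative_eq_intros has_field_derivative_at_within[OF ramp_derivative])
    have "\<bar>y - x\<bar> \<le> \<bar>d\<bar>"
      using y by (auto simp: closed_segment_eq_real_ivl split: if_splits)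
    then have "6 * k * \<bar>y - x\<bar> \<le> 6 * k * \<bar>d\<bar>"
      using assms by (intro mult_left_mono) auto
    then show "norm (ramp' k y - ramp' k x) \<le> 6 * k * \<bar>d\<bar>"
      using ramp'_Lipschitz[OF assms, of y x] by simp
  qed auto
  then have "\<bar>\<phi> (x + d) - \<phi> x\<bar> \<le> 6 * k * d\<^sup>2"
    by (simp add: mult.assoc power2_eq_square)
  moreover have "\<phi> (x + d) - \<phi> x = ramp k (x + d) - ramp k x - d * ramp' k x"
    by (simp add: \<phi>_def algebra_simps)
  ultimately show ?thesis by simp
qed

lemma ramp_range: "k \<ge> 0 \<Longrightarrow> 0 \<le> ramp k x \<and> ramp k x \<le> 1"
proof -
  assume "k \<ge> 0"
  then have "0 < 1 + k * (max 0 x)\<^sup>2"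
    by (intro add_pos_nonneg) auto
  then show ?thesis
    using \<open>k \<ge> 0\<close> unfolding ramp_def by (simp add: divide_le_eq)
qed

lemma ramp_nonpos: "x \<le> 0 \<Longrightarrow> ramp k x = 0" "x \<le> 0 \<Longrightarrow> ramp' k x = 0"
  by (simp_all add: ramp_def ramp'_def)

lemma ramp_tendsto_indicator:
  "(\<lambda>n. ramp (real n) x) \<longlonglongrightarrow> indicator {0<..} x"
proof (cases "x > 0")
  case True
  have "((\<lambda>n. n * x\<^sup>2 / (1 + n * x\<^sup>2)) \<longlongrightarrow> 1) at_top"
    using True by real_asymp
  then have "((\<lambda>n. real n * x\<^sup>2 / (1 + real n * x\<^sup>2)) \<longlongrightarrow> 1) sequentially"
    by (rule filterlim_compose) (rule filterlim_real_sequentially)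
  then show ?thesis
    using True by (simp add: ramp_def)
qed (simp add: ramp_nonpos)

lemma C1b_ramp:
  assumes "k \<ge> 1"
  shows "C1b (\<lambda>x. ramp k (x - p)) (\<lambda>x. ramp' k (x - p))"
proof -
  have k0: "k \<ge> 0" using assms by simp
  have "((\<lambda>x. ramp k (x - p)) has_real_derivative ramp' k (x - p)) (at x within {0..})" for x
    using DERIV_shift[of "ramp k" "ramp' k (x - p)" x "- p"] ramp_derivative[OF k0]
    by (auto intro: has_field_derivative_at_within)
  moreover have "bounded ((\<lambda>x. ramp k (x - p)) ` {0..})"
    using ramp_range[OF k0] by (intro boundedI[where B=1]) auto
  moreover have "bounded ((\<lambda>x. ramp' k (x - p)) ` {0..})"
    using ramp'_bound[OF assms] by (intro boundedI[where B="2 * k"]) auto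
  ultimately show ?thesis
    unfolding C1b_def using ramp'_continuous[OF k0] by auto
qed

section \<open>Finite measures on the half-line\<close>

lemma MF_measurable_continuous:
  assumes "\<zeta> \<in> MF" "continuous_on {0..} f"
  shows "f \<in> borel_measurable \<zeta>"
proof -
  have "f \<in> borel_measurable borel_Rp"
    using assms(2) by (rule borel_measurable_continuous_on_restrict)
  then show ?thesis
    using assms(1) by (simp add: MF_def cong: measurable_cong_sets)
qed

lemma MF_measurable_borel:
  assumes "\<zeta> \<in> MF" "f \<in> borel_measurable borel"
  shows "f \<in> borel_measurable \<zeta>"
proof -
  have "f \<in> borel_measurable borel_Rp"
    using assms(2) by (rule measurable_restrict_space1)
  then show ?thesis
    using assms(1) by (simp add: MF_def cong: measurable_cong_sets)
qed

lemma MF_space: "\<zeta> \<in> MF \<Longrightarrow> space \<zeta> = {0..}"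
  by (auto simp: MF_def space_restrict_space dest: sets_eq_imp_space_eq)

lemma MF_finite: "\<zeta> \<in> MF \<Longrightarrow> finite_measure \<zeta>"
  by (simp add: MF_def)

lemma MF_integrable:
  fixes f :: "real \<Rightarrow> real"
  assumes "\<zeta> \<in> MF" "continuous_on {0..} f" "\<And>x. x \<ge> 0 \<Longrightarrow> \<bar>f x\<bar> \<le> B"
  shows "integrable \<zeta> f"
proof -
  interpret finite_measure \<zeta> using assms(1) by (rule MF_finite)
  show ?thesis
    using assms MF_space[OF assms(1)]
    by (intro integrable_const_bound[of _ B] AE_I2 MF_measurable_continuous) auto
qed

lemma mass_eq_measure: "\<zeta> \<in> MF \<Longrightarrow> mass \<zeta> = measure \<zeta> {0..}"
  using MF_space by (simp add: mass_def pairing_def)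

lemma mass_nonneg: "mass \<zeta> \<ge> 0"
  by (simp add: mass_def pairing_def)

lemma pairing_bound:
  assumes "\<zeta> \<in> MF" "continuous_on {0..} f" "\<And>x. x \<ge> 0 \<Longrightarrow> \<bar>f x\<bar> \<le> B"
  shows "\<bar>pairing f \<zeta>\<bar> \<le> B * mass \<zeta>"
proof -
  interpret finite_measure \<zeta> using assms(1) by (rule MF_finite)
  have "\<bar>pairing f \<zeta>\<bar> \<le> (\<integral>x. \<bar>f x\<bar> \<partial>\<zeta>)"
    unfolding pairing_def by (rule integral_abs_bound)
  also have "\<dots> \<le> (\<integral>x. B \<partial>\<zeta>)"
    using assms MF_space[OF assms(1)] MF_integrable[OF assms]
    by (intro integral_mono) auto
  also have "\<dots> = B * mass \<zeta>"
    by (simp add: mass_def pairing_def)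
  finally show ?thesis .
qed

text \<open>The generators are the traces of the half-lines \<open>{p<..}\<close> on [0, infinity);
  those with p < 0 all become \<open>{0..}\<close>. On this class a measure can be read off from
  limits of ramp pairings.\<close>

lemma sets_borel_Rp_generator:
  "sets borel_Rp = sigma_sets {0..} (insert {0..} ((\<lambda>p. {p<..}) ` {0::real..}))"
proof -
  let ?E = "insert {0..} ((\<lambda>p. {p<..}) ` {0::real..})"
  have "sets (borel::real measure) = sigma_sets UNIV (range greaterThan)"
    by (simp add: borel_Ioi)
  then have "sets borel_Rp = (\<inter>) {0..} ` sigma_sets UNIV (range greaterThan)"
    by (simp add: sets_restrict_space)
  also have "\<dots> = sigma_sets {0..} ((\<inter>) {0..} ` range greaterThan)"
  proof (rule sigma_sets_Int)
    have "{0::real..} \<in> sets borel" by simp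
    then show "{0::real..} \<in> sigma_sets UNIV (range greaterThan)"
      by (simp add: borel_Ioi)
  qed simp
  also have "(\<inter>) {0..} ` range greaterThan = ?E"
  proof (intro equalityI subsetI)
    fix X assume "X \<in> (\<inter>) {0::real..} ` range greaterThan"
    then obtain p where X: "X = {0..} \<inter> {p<..}" by auto
    show "X \<in> ?E"
    proof (cases "p \<ge> 0")
      case True
      then have "X = {p<..}" using X by auto
      then show ?thesis using True by simp
    next
      case False
      then have "X = {0..}" using X by auto
      then show ?thesis by simp
    qed
  next
    fix X assume "X \<in> ?E"
    then consider "X = {0..}" | p where "p \<ge> 0" "X = {p<..}" by auto
    then show "X \<in> (\<inter>) {0::real..} ` range greaterThan"
    proof cases
      case 1
      then have "X = {0..} \<inter> {-1<..}" by auto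
      then show ?thesis by blast
    next
      case 2
      then have "X = {0..} \<inter> {p<..}" by auto
      then show ?thesis by blast
    qed
  qed
  finally show ?thesis .
qed

lemma pairing_ramp_tendsto:
  assumes "\<zeta> \<in> MF"
  shows "(\<lambda>n. pairing (\<lambda>x. ramp (real n) (x - p)) \<zeta>) \<longlonglongrightarrow> pairing (indicator {p<..}) \<zeta>"
proof -
  interpret finite_measure \<zeta> using assms by (rule MF_finite)
  show ?thesis
    unfolding pairing_def
  proof (rule integral_dominated_convergence[where w="\<lambda>_. 1"])
    show "(\<lambda>x. ramp (real n) (x - p)) \<in> borel_measurable \<zeta>" for n
      by (rule MF_measurable_continuous[OF assms ramp_continuous]) simp
    show "indicator {p<..} \<in> borel_measurable \<zeta>"
      by (rule MF_measurable_borel[OF assms]) simp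
    show "AE x in \<zeta>. (\<lambda>n. ramp (real n) (x - p)) \<longlonglongrightarrow> indicator {p<..} x"
    proof (rule AE_I2)
      fix x
      show "(\<lambda>n. ramp (real n) (x - p)) \<longlonglongrightarrow> indicator {p<..} x"
        using ramp_tendsto_indicator[of "x - p"] by (simp add: indicator_def)
    qed
    show "AE x in \<zeta>. norm (ramp (real n) (x - p)) \<le> 1" for n
    proof (rule AE_I2)
      show "norm (ramp (real n) (x - p)) \<le> 1" for x
        using ramp_range[of "real n" "x - p"] by simp
    qed
  qed simp
qed

text \<open>Limits of ramps at shift 0 see only (0, infinity); the absence of an atom at 0 recovers
  the total mass.\<close>

lemma pairing_indicator_eq_mass:
  assumes "\<zeta> \<in> MF" "measure \<zeta> {0} = 0"
  shows "pairing (indicator {0<..}) \<zeta> = mass \<zeta>"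
proof -
  interpret finite_measure \<zeta> using assms(1) by (rule MF_finite)
  have "sets \<zeta> = sets borel_Rp"
    using assms(1) by (simp add: MF_def)
  then have "{0} \<in> sets \<zeta>"
    by (simp add: sets_restrict_space_iff)
  then have "{0} \<in> null_sets \<zeta>"
    using assms(2) by (simp add: null_sets_def emeasure_eq_measure)
  then have "AE x in \<zeta>. x \<notin> {0}"
    by (rule AE_not_in)
  moreover have "AE x in \<zeta>. x \<ge> 0"
    using MF_space[OF assms(1)] by (auto intro: AE_I2)
  ultimately have "AE x in \<zeta>. indicator {0<..} x = (1::real)"
    by eventually_elim auto
  then show ?thesis
    unfolding mass_def pairing_def using assms(1)
    by (intro integral_cong_AE MF_measurable_borel[OF assms(1)]) auto
qed

lemma Int_stable_insert_Ioi: "Int_stable (insert {0..} ((\<lambda>p. {p<..}) ` {0::real..}))"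
proof (rule Int_stableI)
  fix X Y :: "real set"
  assume "X \<in> insert {0..} ((\<lambda>p. {p<..}) ` {0..})" "Y \<in> insert {0..} ((\<lambda>p. {p<..}) ` {0..})"
  then consider "X = {0..}" "Y = {0..}" | q where "X = {0..}" "q \<ge> 0" "Y = {q<..}"
    | p where "Y = {0..}" "p \<ge> 0" "X = {p<..}"
    | p q where "p \<ge> 0" "q \<ge> 0" "X = {p<..}" "Y = {q<..}"
    by blast
  then show "X \<inter> Y \<in> insert {0..} ((\<lambda>p. {p<..}) ` {0..})"
  proof cases
    case 2
    then have "X \<inter> Y = {q<..}" by auto
    then show ?thesis using 2 by auto
  next
    case 3
    then have "X \<inter> Y = {p<..}" by auto
    then show ?thesis using 3 by auto
  next
    case 4
    then have "X \<inter> Y = {max p q<..}" by auto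
    then show ?thesis using 4 by auto
  qed simp
qed

text \<open>Ramps tend to the indicator of \<open>{p<..}\<close>, so all tails agree; the tail at p
  = 0 is the total mass because 0 is no atom. Finite measures that agree on this intersection-stable
  generator coincide.\<close>

lemma MF_eqI:
  assumes "\<zeta> \<in> MF" "\<eta> \<in> MF" "measure \<zeta> {0} = 0" "measure \<eta> {0} = 0"
    and eq: "\<And>n p. n \<ge> 1 \<Longrightarrow> p \<ge> 0 \<Longrightarrow>
      pairing (\<lambda>x. ramp (real n) (x - p)) \<zeta> = pairing (\<lambda>x. ramp (real n) (x - p)) \<eta>"
  shows "\<zeta> = \<eta>"
proof -
  interpret z: finite_measure \<zeta> using assms(1) by (rule MF_finite)
  interpret e: finite_measure \<eta> using assms(2) by (rule MF_finite)
  have ind: "pairing (indicator {p<..}) \<zeta> = pairing (indicator {p<..}) \<eta>" if "p \<ge> 0" for p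
  proof (rule LIMSEQ_unique[OF pairing_ramp_tendsto[OF assms(1)]])
    have "\<forall>\<^sub>F n in sequentially. pairing (\<lambda>x. ramp (real n) (x - p)) \<eta> =
        pairing (\<lambda>x. ramp (real n) (x - p)) \<zeta>"
      using eventually_ge_at_top[of 1] by eventually_elim (use eq that in simp)
    then show "(\<lambda>n. pairing (\<lambda>x. ramp (real n) (x - p)) \<zeta>) \<longlonglongrightarrow> pairing (indicator {p<..}) \<eta>"
      using pairing_ramp_tendsto[OF assms(2)] by (rule Lim_transform_eventually[rotated])
  qed
  have tail: "measure \<zeta> {p<..} = measure \<eta> {p<..}" if "p \<ge> 0" for p
    using ind[OF that] that MF_space[OF assms(1)] MF_space[OF assms(2)]
    by (simp add: pairing_def Int_absorb2 subset_eq)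
  moreover have "measure \<zeta> {0..} = measure \<eta> {0..}"
    using ind[of 0] assms by (simp add: pairing_indicator_eq_mass mass_eq_measure)
  ultimately have "emeasure \<zeta> X = emeasure \<eta> X"
    if "X \<in> insert {0..} ((\<lambda>p. {p<..}) ` {0::real..})" for X
    using that by (auto simp: z.emeasure_eq_measure e.emeasure_eq_measure)
  then show ?thesis
  proof (rule measure_eqI_generator_eq[where A="\<lambda>_. {0..}", rotated 2])
    show "Int_stable (insert {0..} ((\<lambda>p. {p<..}) ` {0::real..}))"
      by (rule Int_stable_insert_Ioi)
    show "sets \<zeta> = sigma_sets {0..} (insert {0..} ((\<lambda>p. {p<..}) ` {0::real..}))"
      "sets \<eta> = sigma_sets {0..} (insert {0..} ((\<lambda>p. {p<..}) ` {0::real..}))"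
      using assms by (simp_all add: MF_def flip: sets_borel_Rp_generator)
  qed auto
qed

section \<open>Pairings with translated ramps as functions of the shift\<close>

lemma pairing_diff:
  "integrable \<zeta> f \<Longrightarrow> integrable \<zeta> g \<Longrightarrow> pairing (\<lambda>x. f x - g x) \<zeta> = pairing f \<zeta> - pairing g \<zeta>"
  by (simp add: pairing_def)

lemma ramp_integrable: "\<zeta> \<in> MF \<Longrightarrow> k \<ge> 0 \<Longrightarrow> integrable \<zeta> (\<lambda>x. ramp k (x - p))"
  using ramp_range[of k] by (intro MF_integrable[where B=1] ramp_continuous) auto

lemma ramp'_integrable: "\<zeta> \<in> MF \<Longrightarrow> k \<ge> 1 \<Longrightarrow> integrable \<zeta> (\<lambda>x. ramp' k (x - p))"
  by (intro MF_integrable[where B="2 * k"] ramp'_continuous ramp'_bound) auto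

text \<open>Differentiation under the integral: the remainder of \<open>ramp_Taylor\<close> for the
  increment \<open>- h\<close> integrates to at most 6 k h^2 times the mass.\<close>

lemma pairing_ramp_derivative:
  assumes "\<zeta> \<in> MF" "k \<ge> 1"
  shows "((\<lambda>p. pairing (\<lambda>x. ramp k (x - p)) \<zeta>) has_real_derivative
    - pairing (\<lambda>x. ramp' k (x - p)) \<zeta>) (at p)"
proof -
  let ?I = "\<lambda>p. pairing (\<lambda>x. ramp k (x - p)) \<zeta>" and ?I' = "pairing (\<lambda>x. ramp' k (x - p)) \<zeta>"
  have k0: "k \<ge> 0" using assms by simp
  have bound: "\<bar>?I (p + h) - ?I p + h * ?I'\<bar> \<le> 6 * k * h\<^sup>2 * mass \<zeta>" for h
  proof -
    have "?I (p + h) - ?I p + h * ?I' =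
        pairing (\<lambda>x. ramp k (x - (p + h)) - ramp k (x - p) - (- h) * ramp' k (x - p)) \<zeta>"
      using ramp_integrable[OF assms(1) k0] ramp'_integrable[OF assms]
      by (simp add: pairing_def)
    also have "\<bar>\<dots>\<bar> \<le> 6 * k * h\<^sup>2 * mass \<zeta>"
    proof (rule pairing_bound[OF assms(1)])
      show "continuous_on {0..} (\<lambda>x. ramp k (x - (p + h)) - ramp k (x - p) - (- h) * ramp' k (x - p))"
        by (intro continuous_intros ramp_continuous ramp'_continuous k0)
      show "\<bar>ramp k (x - (p + h)) - ramp k (x - p) - (- h) * ramp' k (x - p)\<bar> \<le> 6 * k * h\<^sup>2" for x
        using ramp_Taylor[OF assms(2), of "x - p" "- h"] by (simp add: algebra_simps)
    qed
    finally show ?thesis .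
  qed
  have "((\<lambda>h. (?I (p + h) - ?I p) / h - (- ?I')) \<longlongrightarrow> 0) (at 0)"
  proof (rule Lim_null_comparison)
    show "\<forall>\<^sub>F h in at 0. norm ((?I (p + h) - ?I p) / h - (- ?I')) \<le> 6 * k * \<bar>h\<bar> * mass \<zeta>"
    proof (rule eventually_at_filter[THEN iffD2], intro always_eventually allI impI)
      fix h :: real assume "h \<noteq> 0"
      then have "(?I (p + h) - ?I p) / h - (- ?I') = (?I (p + h) - ?I p + h * ?I') / h"
        by (simp add: field_simps)
      also have "norm \<dots> \<le> (6 * k * h\<^sup>2 * mass \<zeta>) / \<bar>h\<bar>"
        using bound[of h] by (simp add: divide_right_mono)
      also have "\<dots> = 6 * k * \<bar>h\<bar>\<^sup>2 * mass \<zeta> / \<bar>h\<bar>"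
        by simp
      also have "\<dots> = 6 * k * \<bar>h\<bar> * mass \<zeta>"
        using \<open>h \<noteq> 0\<close> unfolding power2_eq_square by (simp del: abs_mult_self_eq)
      finally show "norm ((?I (p + h) - ?I p) / h - (- ?I')) \<le> 6 * k * \<bar>h\<bar> * mass \<zeta>" .
    qed
    show "((\<lambda>h. 6 * k * \<bar>h\<bar> * mass \<zeta>) \<longlongrightarrow> 0) (at 0)"
      by (intro tendsto_eq_intros) auto
  qed
  then show ?thesis
    unfolding DERIV_def by (rule LIM_zero_cancel)
qed

text \<open>The constant depends on the measure only through its mass, which later gives joint
  continuity in time and shift.\<close>

lemma pairing_ramp'_Lipschitz:
  assumes "\<zeta> \<in> MF" "k \<ge> 1"
  shows "\<bar>pairing (\<lambda>x. ramp' k (x - p)) \<zeta> - pairing (\<lambda>x. ramp' k (x - q)) \<zeta>\<bar> \<le> 6 * k * \<bar>p - q\<bar> * mass \<zeta>"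
proof -
  have "pairing (\<lambda>x. ramp' k (x - p)) \<zeta> - pairing (\<lambda>x. ramp' k (x - q)) \<zeta> =
      pairing (\<lambda>x. ramp' k (x - p) - ramp' k (x - q)) \<zeta>"
    using ramp'_integrable[OF assms] by (simp add: pairing_diff)
  also have "\<bar>\<dots>\<bar> \<le> 6 * k * \<bar>p - q\<bar> * mass \<zeta>"
  proof (rule pairing_bound[OF assms(1)])
    show "continuous_on {0..} (\<lambda>x. ramp' k (x - p) - ramp' k (x - q))"
      using assms by (intro continuous_intros ramp'_continuous) auto
    show "\<bar>ramp' k (x - p) - ramp' k (x - q)\<bar> \<le> 6 * k * \<bar>p - q\<bar>" for x
      using ramp'_Lipschitz[OF assms(2), of "x - p" "x - q"] by (simp add: abs_minus_commute)
  qed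
  finally show ?thesis .
qed

lemma MF_eqI_mass_zero:
  assumes "\<zeta> \<in> MF" "\<eta> \<in> MF" "mass \<zeta> = 0" "mass \<eta> = 0"
  shows "\<zeta> = \<eta>"
proof (rule measure_eqI)
  show "sets \<zeta> = sets \<eta>" using assms by (simp add: MF_def)
  have zero: "emeasure M A = 0" if "M \<in> MF" "mass M = 0" for M and A :: "real set"
  proof -
    interpret finite_measure M using that(1) by (rule MF_finite)
    have "measure M A \<le> measure M (space M)"
      by (rule bounded_measure)
    then have "measure M A = 0"
      using that(2) MF_space[OF that(1)] mass_eq_measure[OF that(1)]
      by (intro antisym measure_nonneg) simp
    then show ?thesis by (simp add: emeasure_eq_measure)
  qed
  show "emeasure \<zeta> A = emeasure \<eta> A" for A
    using zero[of \<zeta> A] zero[of \<eta> A] assms by simp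
qed

text \<open>Dominated convergence: at each \<open>x\<close> the integrand is 0 once n >= x. This
  fixes the constant of integration when integrating in the shift.\<close>

lemma pairing_ramp_vanish:
  assumes "\<zeta> \<in> MF" "k \<ge> 0"
  shows "(\<lambda>n. pairing (\<lambda>x. ramp k (x - real n)) \<zeta>) \<longlonglongrightarrow> 0"
proof -
  interpret finite_measure \<zeta> using assms(1) by (rule MF_finite)
  have "(\<lambda>n. \<integral>x. ramp k (x - real n) \<partial>\<zeta>) \<longlonglongrightarrow> (\<integral>x. 0 \<partial>\<zeta>)"
  proof (rule integral_dominated_convergence[where w="\<lambda>_. 1"])
    show "(\<lambda>x. ramp k (x - real n)) \<in> borel_measurable \<zeta>" for n
      by (rule MF_measurable_continuous[OF assms(1) ramp_continuous[OF assms(2)]])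
    show "AE x in \<zeta>. (\<lambda>n. ramp k (x - real n)) \<longlonglongrightarrow> 0"
    proof (rule AE_I2)
      fix x
      have "\<forall>\<^sub>F n in sequentially. real n \<ge> x"
        using filterlim_real_sequentially unfolding filterlim_at_top by blast
      then have "\<forall>\<^sub>F n in sequentially. 0 = ramp k (x - real n)"
        by eventually_elim (simp add: ramp_nonpos)
      then show "(\<lambda>n. ramp k (x - real n)) \<longlonglongrightarrow> 0"
        by (rule Lim_transform_eventually[OF tendsto_const])
    qed
    show "AE x in \<zeta>. norm (ramp k (x - real n)) \<le> 1" for n
      using ramp_range[OF assms(2)] by simp
  qed simp_all
  then show ?thesis by (simp add: pairing_def)
qed

text \<open>Integration in the shift: equality of the \<open>ramp'\<close> pairings gives the
  difference \<open>D\<close> of the \<open>ramp\<close> pairings zero derivative on [0, infinity),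
  and \<open>D\<close> tends to 0 as the ramps move to infinity. Hence the ramp pairings agree and
  \<open>MF_eqI\<close> applies.\<close>

lemma MF_eqI_ramp':
  assumes "\<zeta> \<in> MF" "\<eta> \<in> MF" "measure \<zeta> {0} = 0" "measure \<eta> {0} = 0"
    and eq: "\<And>k p. k \<ge> 1 \<Longrightarrow> p \<ge> 0 \<Longrightarrow>
      pairing (\<lambda>x. ramp' k (x - p)) \<zeta> = pairing (\<lambda>x. ramp' k (x - p)) \<eta>"
  shows "\<zeta> = \<eta>"
proof (rule MF_eqI[OF assms(1-4)])
  fix n :: nat and p :: real assume n: "n \<ge> 1" and p: "p \<ge> 0"
  then have k: "real n \<ge> 1" by simp
  define D where "D p = pairing (\<lambda>x. ramp (real n) (x - p)) \<zeta> - pairing (\<lambda>x. ramp (real n) (x - p)) \<eta>" for p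
  have "(D has_field_derivative 0) (at p within {0..})" if "p \<in> {0..}" for p
  proof -
    have "(D has_field_derivative (- pairing (\<lambda>x. ramp' (real n) (x - p)) \<zeta>
        - (- pairing (\<lambda>x. ramp' (real n) (x - p)) \<eta>))) (at p)"
      unfolding D_def[abs_def] by (intro DERIV_diff pairing_ramp_derivative assms k)
    then show ?thesis
      using eq[OF k, of p] that by (auto intro: has_field_derivative_at_within)
  qed
  then obtain d where d: "\<And>p. p \<ge> 0 \<Longrightarrow> D p = d"
    using has_field_derivative_zero_constant[of "{0..}" D] by auto
  have "(\<lambda>m. D (real m)) \<longlonglongrightarrow> 0 - 0"
    unfolding D_def by (intro tendsto_diff pairing_ramp_vanish assms) simp_all
  then have "d = 0"
    by (simp add: d LIMSEQ_const_iff)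
  then show "pairing (\<lambda>x. ramp (real n) (x - p)) \<zeta> = pairing (\<lambda>x. ramp (real n) (x - p)) \<eta>"
    using d[OF p] by (simp add: D_def)
qed

section \<open>The excess lifetime measure\<close>

lemma critical_data_MF: "critical_data \<alpha> \<nu> \<Longrightarrow> \<nu> \<in> MF"
  by (simp add: critical_data_def MF_def prob_space.finite_measure)

text \<open>A zero mean would concentrate \<open>\<nu>\<close> at 0, contrary to
  \<open>measure \<nu> {0} = 0\<close>; hence the quotient defining \<open>\<alpha>\<close> is a
  true inverse and not the default value 1 / 0 = 0.\<close>

lemma critical_data_mean:
  assumes "critical_data \<alpha> \<nu>"
  shows "\<alpha> > 0" "\<alpha> * pairing (\<lambda>x. x) \<nu> = 1"
proof -
  interpret prob_space \<nu> using assms by (simp add: critical_data_def)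
  have sp: "space \<nu> = {0..}"
    using assms by (intro MF_space critical_data_MF)
  have int: "integrable \<nu> (\<lambda>x. x)" and \<alpha>: "\<alpha> = 1 / pairing (\<lambda>x. x) \<nu>"
    and z: "measure \<nu> {0} = 0"
    using assms by (auto simp: critical_data_def)
  have nn: "AE x in \<nu>. 0 \<le> x"
    using sp by (auto intro: AE_I2)
  have "pairing (\<lambda>x. x) \<nu> \<noteq> 0"
  proof
    assume "pairing (\<lambda>x. x) \<nu> = 0"
    then have "AE x in \<nu>. x = 0"
      using integral_nonneg_eq_0_iff_AE[OF int nn] by (simp add: pairing_def)
    moreover have [measurable]: "(\<lambda>x. x) \<in> borel_measurable \<nu>"
      using int by auto
    have "{x \<in> space \<nu>. x = 0} \<in> events"
      by measurable
    moreover note calculation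
    ultimately have "prob {x \<in> space \<nu>. x = 0} = 1"
      by (subst prob_eq_1) auto
    moreover have "{x \<in> space \<nu>. x = 0} = {0}"
      using sp by auto
    ultimately show False using z by simp
  qed
  moreover have "pairing (\<lambda>x. x) \<nu> \<ge> 0"
    unfolding pairing_def using nn by (rule integral_nonneg_AE)
  ultimately show "\<alpha> > 0" "\<alpha> * pairing (\<lambda>x. x) \<nu> = 1"
    by (auto simp: \<alpha>)
qed

lemma one_minus_dist_fun:
  assumes "critical_data \<alpha> \<nu>" "y \<ge> 0"
  shows "1 - dist_fun \<nu> y = measure \<nu> {y<..}"
proof -
  interpret prob_space \<nu> using assms by (simp add: critical_data_def)
  have sp: "space \<nu> = {0..}" and "sets \<nu> = sets borel_Rp"
    using MF_space[OF critical_data_MF[OF assms(1)]] assms(1) by (simp_all add: critical_data_def)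
  then have "{0..y} \<in> sets \<nu>"
    by (simp add: sets_restrict_space_iff)
  moreover have "space \<nu> - {0..y} = {y<..}"
    unfolding sp using assms(2) by (simp add: set_eq_iff not_le) (meson le_less_trans less_imp_le not_le)
  ultimately show ?thesis
    using prob_compl[of "{0..y}"] by (simp add: dist_fun_def)
qed

lemma dist_fun_measurable:
  assumes "critical_data \<alpha> \<nu>"
  shows "dist_fun \<nu> \<in> borel_measurable borel"
proof (rule borel_measurable_mono)
  interpret prob_space \<nu> using assms by (simp add: critical_data_def)
  have "sets \<nu> = sets borel_Rp"
    using assms by (simp add: critical_data_def)
  then have "{0..y} \<in> sets \<nu>" for y
    by (simp add: sets_restrict_space_iff)
  \<comment> \<open>For y < 0 the interval is empty, so monotonicity holds on the whole
    line.\<close>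
  then show "mono (dist_fun \<nu>)"
    by (auto simp: mono_def dist_fun_def intro!: finite_measure_mono)
qed

text \<open>Since g(0) = 0, \<open>g x\<close> is the integral of \<open>g'\<close> over [0, x];
  exchanging the order of integration weights \<open>g' y\<close> with the tail
  \<open>measure \<nu> {y<..}\<close>. The bound is on \<open>g'\<close> and not on
  \<open>g\<close>, so that g(x) = x is covered.\<close>

lemma has_bochner_integral_tail:
  assumes cd: "critical_data \<alpha> \<nu>"
    and deriv: "\<And>x. x \<ge> 0 \<Longrightarrow> (g has_real_derivative g' x) (at x within {0..})"
    and cont: "continuous_on {0..} g'" and bound: "\<And>x. x \<ge> 0 \<Longrightarrow> \<bar>g' x\<bar> \<le> B" and "g 0 = 0"
  shows "has_bochner_integral lborel (\<lambda>y. indicator {0..} y * ((1 - dist_fun \<nu> y) * g' y)) (pairing g \<nu>)"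
proof -
  interpret prob_space \<nu> using cd by (simp add: critical_data_def)
  interpret pair_sigma_finite \<nu> lborel ..
  have MF: "\<nu> \<in> MF" and sp: "space \<nu> = {0..}" and int: "integrable \<nu> (\<lambda>x. x)"
    using critical_data_MF[OF cd] MF_space[OF critical_data_MF[OF cd]] cd by (simp_all add: critical_data_def)
  have id [measurable]: "(\<lambda>x. x) \<in> borel_measurable \<nu>"
    using int by auto
  define G where "G y = indicator {0..} y * g' y" for y
  have G [measurable]: "G \<in> borel_measurable borel"
    using borel_measurable_continuous_on_restrict[OF cont]
    by (simp add: borel_measurable_restrict_space_iff G_def[abs_def])
  \<comment> \<open>The strict inequality y < x makes the section in \<open>x\<close> the tail
    \<open>{y<..}\<close>; the section in \<open>y\<close> then misses only the null point y = x of
    [0, x].\<close>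
  define f where "f x y = indicator {..<x} y * G y" for x y
  have f [measurable]: "case_prod f \<in> borel_measurable (\<nu> \<Otimes>\<^sub>M lborel)"
  proof -
    have "case_prod f = (\<lambda>z. if snd z < fst z then G (snd z) else 0)"
      by (auto simp: f_def indicator_def fun_eq_iff)
    also have "\<dots> \<in> borel_measurable (\<nu> \<Otimes>\<^sub>M lborel)"
      by measurable
    finally show ?thesis .
  qed
  have GB: "\<bar>f x y\<bar> \<le> B * indicator {0..x} y" for x y
    using bound[of y] by (auto simp: f_def G_def indicator_def)
  have int_cB: "integrable lborel (\<lambda>y. B * indicator {0..x} y)" for x :: real
    by (rule integrable_mult_right) (simp add: integrable_indicator_iff emeasure_lborel_Icc_eq)
  have int_f: "integrable lborel (f x)" if "x \<ge> 0" for x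
  proof (rule Bochner_Integration.integrable_bound[OF int_cB[of x]])
    show "AE y in lborel. norm (f x y) \<le> norm (B * indicator {0..x} y)"
      using GB[of x] by (auto intro: order_trans[OF _ abs_ge_self])
  qed (simp add: f_def[abs_def])
  have int_pair: "integrable (\<nu> \<Otimes>\<^sub>M lborel) (case_prod f)"
  proof (rule Fubini_integrable[OF f])
    \<comment> \<open>The inner integral over [0, x] is at most B x, which is integrable because the
      mean of \<open>\<nu>\<close> is finite.\<close>
    show "integrable \<nu> (\<lambda>x. \<integral>y. norm (case (x, y) of (x, y) \<Rightarrow> f x y) \<partial>lborel)"
    proof (rule Bochner_Integration.integrable_bound[of _ "\<lambda>x. x * B"])
      show "integrable \<nu> (\<lambda>x. x * B)" using int by simp
      show "AE x in \<nu>. norm (\<integral>y. norm (case (x, y) of (x, y) \<Rightarrow> f x y) \<partial>lborel) \<le> norm (x * B)"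
      proof (rule AE_I2)
        fix x assume "x \<in> space \<nu>"
        then have x: "x \<ge> 0" using sp by simp
        have "(\<integral>y. norm (f x y) \<partial>lborel) \<le> (\<integral>y. B * indicator {0..x} y \<partial>lborel)"
          using int_f[OF x] int_cB[of x] GB by (intro integral_mono) auto
        then show "norm (\<integral>y. norm (case (x, y) of (x, y) \<Rightarrow> f x y) \<partial>lborel) \<le> norm (x * B)"
          using x order_trans[OF _ abs_ge_self[of "x * B"]] by (simp add: mult.commute)
      qed
    qed measurable
    show "AE x in \<nu>. integrable lborel (\<lambda>y. case (x, y) of (x, y) \<Rightarrow> f x y)"
      using int_f sp by (auto intro!: AE_I2)
  qed
  have inner1: "(\<integral>x. f x y \<partial>\<nu>) = indicator {0..} y * ((1 - dist_fun \<nu> y) * g' y)" for y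
  proof (cases "y \<ge> 0")
    case True
    have "(\<integral>x. f x y \<partial>\<nu>) = (\<integral>x. indicator {y<..} x * G y \<partial>\<nu>)"
      by (intro Bochner_Integration.integral_cong) (auto simp: f_def indicator_def)
    also have "\<dots> = measure \<nu> {y<..} * G y"
      using sp True by (simp add: Int_absorb2 subset_eq)
    finally show ?thesis
      using True by (simp add: one_minus_dist_fun[OF cd True] G_def)
  qed (simp add: f_def G_def)
  have inner2: "(\<integral>y. f x y \<partial>lborel) = g x" if "x \<ge> 0" for x
  proof -
    have "(\<integral>y. f x y \<partial>lborel) = (\<integral>y. indicator {0..x} y *\<^sub>R g' y \<partial>lborel)"
    proof (rule integral_cong_AE)
      have "continuous_on {0..x} g'"
        using cont by (rule continuous_on_subset) auto
      then show "(\<lambda>y. indicator {0..x} y *\<^sub>R g' y) \<in> borel_measurable lborel"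
        using borel_measurable_continuous_on_restrict[of "{0..x}" g']
        by (simp add: borel_measurable_restrict_space_iff)
      show "AE y in lborel. f x y = indicator {0..x} y *\<^sub>R g' y"
        using AE_lborel_singleton[of x]
        by eventually_elim (auto simp: f_def G_def indicator_def)
    qed (simp add: f_def[abs_def])
    also have "\<dots> = g x - g 0"
    proof (rule integral_FTC_atLeastAtMost[OF that])
      show "(g has_vector_derivative g' y) (at y within {0..x})" if "0 \<le> y" for y
        using deriv[OF that] unfolding has_real_derivative_iff_has_vector_derivative
        by (rule has_vector_derivative_within_subset) auto
    qed (rule continuous_on_subset[OF cont], auto)
    finally show ?thesis using \<open>g 0 = 0\<close> by simp
  qed
  have "has_bochner_integral lborel (\<lambda>y. \<integral>x. f x y \<partial>\<nu>) (\<integral>x. (\<integral>y. f x y \<partial>lborel) \<partial>\<nu>)"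
    unfolding has_bochner_integral_iff
    using integrable_snd[OF int_pair] Fubini_integral[OF int_pair] by simp
  also have "(\<integral>x. (\<integral>y. f x y \<partial>lborel) \<partial>\<nu>) = pairing g \<nu>"
    unfolding pairing_def using inner2 sp by (intro Bochner_Integration.integral_cong) auto
  finally show ?thesis
    unfolding inner1 .
qed

lemma has_bochner_integral_excess_lifetime:
  assumes cd: "critical_data \<alpha> \<nu>"
    and deriv: "\<And>x. x \<ge> 0 \<Longrightarrow> (g has_real_derivative g' x) (at x within {0..})"
    and cont: "continuous_on {0..} g'" and bound: "\<And>x. x \<ge> 0 \<Longrightarrow> \<bar>g' x\<bar> \<le> B" and "g 0 = 0"
  shows "has_bochner_integral (excess_lifetime \<alpha> \<nu>) g' (\<alpha> * pairing g \<nu>)"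
  unfolding excess_lifetime_def
proof (rule has_bochner_integral_density)
  note [measurable] = dist_fun_measurable[OF cd]
  show "g' \<in> borel_measurable (restrict_space lborel {0..})"
    using borel_measurable_continuous_on_restrict[OF cont]
    by (simp add: borel_measurable_restrict_space_iff)
  show "(\<lambda>x. \<alpha> * (1 - dist_fun \<nu> x)) \<in> borel_measurable (restrict_space lborel {0..})"
    by (rule measurable_restrict_space1) measurable
  show "AE x in restrict_space lborel {0..}. 0 \<le> \<alpha> * (1 - dist_fun \<nu> x)"
    using critical_data_mean[OF cd] one_minus_dist_fun[OF cd]
    by (intro AE_I2) (auto simp: space_restrict_space)
  have "has_bochner_integral lborel (\<lambda>x. \<alpha> * (indicator {0..} x * ((1 - dist_fun \<nu> x) * g' x)))
     (\<alpha> * pairing g \<nu>)"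
    by (rule has_bochner_integral_mult_right) (rule has_bochner_integral_tail[OF assms])
  then show "has_bochner_integral (restrict_space lborel {0..})
     (\<lambda>x. (\<alpha> * (1 - dist_fun \<nu> x)) *\<^sub>R g' x) (\<alpha> * pairing g \<nu>)"
    by (subst has_bochner_integral_restrict_space) (simp_all add: ac_simps)
qed

text \<open>The mass is the preceding identity for g(x) = x, since \<alpha> times the mean is 1.
  Points are null because the measure has a density with respect to Lebesgue measure.\<close>

lemma
  assumes cd: "critical_data \<alpha> \<nu>"
  shows excess_lifetime_MF: "excess_lifetime \<alpha> \<nu> \<in> MF"
    and mass_excess_lifetime: "mass (excess_lifetime \<alpha> \<nu>) = 1"
    and emeasure_excess_lifetime_singleton: "emeasure (excess_lifetime \<alpha> \<nu>) {x} = 0"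
proof -
  have one: "has_bochner_integral (excess_lifetime \<alpha> \<nu>) (\<lambda>_. 1::real) 1"
    using has_bochner_integral_excess_lifetime[OF cd, of "\<lambda>x. x" "\<lambda>_. 1" 1] critical_data_mean[OF cd]
    by simp
  then have "integrable (excess_lifetime \<alpha> \<nu>) (\<lambda>_. 1::real)"
    by (auto simp: has_bochner_integral_iff)
  then have "finite_measure (excess_lifetime \<alpha> \<nu>)"
    by (intro finite_measureI) (simp add: integrable_iff_bounded less_top)
  moreover have "sets (excess_lifetime \<alpha> \<nu>) = sets borel_Rp"
    by (simp add: excess_lifetime_def sets_restrict_space)
  ultimately show "excess_lifetime \<alpha> \<nu> \<in> MF"
    by (simp add: MF_def)
  show "mass (excess_lifetime \<alpha> \<nu>) = 1"
    unfolding mass_def pairing_def by (rule has_bochner_integral_integral_eq[OF one])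
  note [measurable] = dist_fun_measurable[OF cd]
  have meas: "(\<lambda>x. ennreal (\<alpha> * (1 - dist_fun \<nu> x))) \<in> borel_measurable (restrict_space lborel {0..})"
    by (rule measurable_restrict_space1) measurable
  have "AE y in lborel. y \<in> {0..} \<longrightarrow> y \<noteq> x"
    using AE_lborel_singleton[of x] by eventually_elim simp
  then have "AE y in restrict_space lborel {0..}. y \<noteq> x"
    by (subst AE_restrict_space_iff) auto
  then have "AE y in restrict_space lborel {0..}. 0 < ennreal (\<alpha> * (1 - dist_fun \<nu> y)) \<longrightarrow> y \<noteq> x"
    by eventually_elim simp
  then have AE: "AE y in excess_lifetime \<alpha> \<nu>. y \<noteq> x"
    unfolding excess_lifetime_def by (simp only: AE_density[OF meas])
  show "emeasure (excess_lifetime \<alpha> \<nu>) {x} = 0"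
  \<comment> \<open>For x < 0 the singleton lies outside the half-line and \<open>emeasure\<close>
    takes its default value 0.\<close>
  proof (cases "{x} \<in> sets (excess_lifetime \<alpha> \<nu>)")
    case True
    then have "{y \<in> space (excess_lifetime \<alpha> \<nu>). \<not> y \<noteq> x} = {x}"
      using sets.sets_into_space by auto
    then show ?thesis
      using AE AE_iff_measurable[OF True, of "\<lambda>y. y \<noteq> x"] by simp
  qed (rule emeasure_notin_sets)
qed

section \<open>Scalar multiples of the excess lifetime measure\<close>

lemma scale_measure_eq_density: "scale_measure r M = density M (\<lambda>_. r)"
proof (rule measure_eqI)
  fix A assume "A \<in> sets (scale_measure r M)"
  then have "A \<in> sets M" by simp
  then show "emeasure (scale_measure r M) A = emeasure (density M (\<lambda>_. r)) A"
    by (simp add: emeasure_density nn_integral_cmult_indicator)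
qed simp

lemma pairing_scale_measure:
  assumes "c \<ge> 0" "f \<in> borel_measurable M"
  shows "pairing f (scale_measure (ennreal c) M) = c * pairing f M"
  unfolding pairing_def scale_measure_eq_density using assms
  by (subst integral_density) auto

lemma mass_scale_measure: "c \<ge> 0 \<Longrightarrow> mass (scale_measure (ennreal c) M) = c * mass M"
  unfolding mass_def by (rule pairing_scale_measure) auto

lemma scale_measure_MF:
  assumes "M \<in> MF"
  shows "scale_measure (ennreal c) M \<in> MF"
proof -
  interpret finite_measure M using assms by (rule MF_finite)
  have "finite_measure (scale_measure (ennreal c) M)"
    by (rule finite_measureI) (simp add: space_scale_measure ennreal_mult_eq_top_iff)
  then show ?thesis using assms by (simp add: MF_def)
qed

lemma scale_excess_lifetime_MFc:
  assumes "critical_data \<alpha> \<nu>" "c \<ge> 0"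
  shows "scale_measure (ennreal c) (excess_lifetime \<alpha> \<nu>) \<in> MFc"
  using scale_measure_MF[OF excess_lifetime_MF[OF assms(1)]]
    emeasure_excess_lifetime_singleton[OF assms(1)] assms(2)
  by (simp add: MFc_def measure_def)

text \<open>The balance behind stationarity: for c > 0, division by the mass c leaves
  \<open>\<alpha> * pairing g \<nu>\<close>, exactly the source rate of the fluid equation.\<close>

lemma pairing_scale_excess_lifetime:
  assumes "critical_data \<alpha> \<nu>" "c \<ge> 0" "C1b g g'" "g 0 = 0"
  shows "pairing g' (scale_measure (ennreal c) (excess_lifetime \<alpha> \<nu>)) = c * (\<alpha> * pairing g \<nu>)"
proof -
  have g: "\<And>x. x \<ge> 0 \<Longrightarrow> (g has_real_derivative g' x) (at x within {0..})"
    "continuous_on {0..} g'" "bounded (g' ` {0..})"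
    using assms(3) by (simp_all add: C1b_def)
  from g(3) obtain B where "\<And>x. x \<ge> 0 \<Longrightarrow> \<bar>g' x\<bar> \<le> B"
    by (auto simp: bounded_iff)
  then have "has_bochner_integral (excess_lifetime \<alpha> \<nu>) g' (\<alpha> * pairing g \<nu>)"
    by (intro has_bochner_integral_excess_lifetime[OF assms(1) g(1,2) _ assms(4)])
  then have "pairing g' (excess_lifetime \<alpha> \<nu>) = \<alpha> * pairing g \<nu>"
    unfolding pairing_def by (rule has_bochner_integral_integral_eq)
  then show ?thesis
    using pairing_scale_measure[OF assms(2) MF_measurable_continuous[OF excess_lifetime_MF[OF assms(1)] g(2)]]
    by simp
qed

section \<open>Fluid model solutions\<close>

lemma t_star_infinite:
  assumes "\<And>t. t \<ge> 0 \<Longrightarrow> mass (\<mu> t) \<noteq> 0"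
  shows "t_star \<mu> = \<infinity>"
proof -
  have "{s. 0 \<le> s \<and> mass (\<mu> s) = 0} = {}" using assms by auto
  then show ?thesis by (simp only: t_star_def image_empty Inf_empty top_ereal_def)
qed

lemma t_star_le: "s \<ge> 0 \<Longrightarrow> mass (\<mu> s) = 0 \<Longrightarrow> t_star \<mu> \<le> ereal s"
  unfolding t_star_def by (rule Inf_lower) auto

lemma t_star_nonneg: "t_star \<mu> \<ge> 0"
  unfolding t_star_def by (rule Inf_greatest) auto

lemma continuous_map_const_weak_topology:
  assumes "\<xi> \<in> MF"
  shows "continuous_map X weak_topology (\<lambda>_. \<xi>)"
proof -
  \<comment> \<open>The topspace is the union of the generators; the one for f = 0 and U =
    \<open>UNIV\<close> is all of \<open>MF\<close>.\<close>
  have "{\<zeta> \<in> MF. pairing (\<lambda>_. 0) \<zeta> \<in> UNIV} \<in> {{\<zeta> \<in> MF. pairing f \<zeta> \<in> U} | f U.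
        continuous_on {0..} f \<and> bounded (f ` {0..}) \<and> open U}"
    by (intro CollectI exI[of _ "\<lambda>_. 0"] exI[of _ UNIV] conjI refl) (auto intro: bounded_subset[of "{0}"])
  then have "\<xi> \<in> topspace weak_topology"
    using assms unfolding weak_topology_def topology_generated_by_topspace by blast
  then show ?thesis by simp
qed

lemma continuous_pairing:
  assumes "continuous_map (top_of_set S) weak_topology \<mu>"
    and "continuous_on {0..} f" "bounded (f ` {0..})"
    and MF: "\<And>t. t \<in> S \<Longrightarrow> \<mu> t \<in> MF"
  shows "continuous_on S (\<lambda>t. pairing f (\<mu> t))"
  unfolding continuous_on_open_invariant
proof (intro allI impI)
  fix U :: "real set" assume "open U"
  then have "openin weak_topology {\<zeta> \<in> MF. pairing f \<zeta> \<in> U}"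
    unfolding weak_topology_def using assms(2,3) by (intro topology_generated_by_Basis) blast
  then have "openin (top_of_set S) {t \<in> topspace (top_of_set S). \<mu> t \<in> {\<zeta> \<in> MF. pairing f \<zeta> \<in> U}}"
    by (rule openin_continuous_map_preimage[OF assms(1)])
  moreover have "{t \<in> topspace (top_of_set S). \<mu> t \<in> {\<zeta> \<in> MF. pairing f \<zeta> \<in> U}} = (\<lambda>t. pairing f (\<mu> t)) -` U \<inter> S"
    using MF by auto
  ultimately have "openin (top_of_set S) ((\<lambda>t. pairing f (\<mu> t)) -` U \<inter> S)"
    by simp
  then show "\<exists>A. open A \<and> A \<inter> S = (\<lambda>t. pairing f (\<mu> t)) -` U \<inter> S"
    by (auto simp: openin_open)
qed

text \<open>For c > 0 transport and source cancel at every time. For c = 0 the mass vanishes from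
  the start, so no time precedes \<open>t_star\<close> and the fluid equation is void.\<close>

lemma constant_fluid_model_solution:
  assumes cd: "critical_data \<alpha> \<nu>" and c: "c \<ge> 0"
  defines "\<xi> \<equiv> scale_measure (ennreal c) (excess_lifetime \<alpha> \<nu>)"
  shows "fluid_model_solution \<alpha> \<nu> (\<lambda>_. \<xi>)"
proof -
  have MF: "\<xi> \<in> MF" and atom: "measure \<xi> {0} = 0"
    using scale_excess_lifetime_MFc[OF cd c] by (simp_all add: MFc_def \<xi>_def)
  have mass: "mass \<xi> = c"
    using c mass_excess_lifetime[OF cd] by (simp add: \<xi>_def mass_scale_measure)
  have "pairing g \<xi> = pairing g \<xi> - integral {0..t} (\<lambda>s. pairing g' \<xi> / mass \<xi>) + \<alpha> * t * pairing g \<nu>"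
    if g: "C1b g g'" "g 0 = 0" and t: "0 \<le> t" "ereal t < t_star (\<lambda>_. \<xi>)" for g g' t
  proof -
    have "c \<noteq> 0"
    proof
      assume "c = 0"
      then have "t_star (\<lambda>_. \<xi>) \<le> ereal t" using t_star_le[of t "\<lambda>_. \<xi>"] mass t by simp
      then show False using t by simp
    qed
    moreover have "pairing g' \<xi> = c * (\<alpha> * pairing g \<nu>)"
      unfolding \<xi>_def by (rule pairing_scale_excess_lifetime[OF cd c g])
    ultimately show ?thesis using t by (simp add: mass)
  qed
  moreover have "mass \<xi> = 0" if "t_star (\<lambda>_. \<xi>) \<le> ereal t" for t
    using t_star_infinite[of "\<lambda>_. \<xi>"] that by (cases "mass \<xi> = 0") simp_all
  ultimately show ?thesis
    unfolding fluid_model_solution_def using MF atom continuous_map_const_weak_topology[OF MF] by simp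
qed

lemma fluid_model_solutionD:
  assumes "fluid_model_solution \<alpha> \<nu> \<mu>"
  shows "t \<ge> 0 \<Longrightarrow> \<mu> t \<in> MF"
    and "continuous_map (top_of_set {0..}) weak_topology \<mu>"
    and "t \<ge> 0 \<Longrightarrow> measure (\<mu> t) {0} = 0"
    and "C1b g g' \<Longrightarrow> g 0 = 0 \<Longrightarrow> g' 0 = 0 \<Longrightarrow> t \<ge> 0 \<Longrightarrow> ereal t < t_star \<mu> \<Longrightarrow>
      pairing g (\<mu> t) = pairing g (\<mu> 0) - integral {0..t} (\<lambda>s. pairing g' (\<mu> s) / mass (\<mu> s))
        + \<alpha> * t * pairing g \<nu>"
    and "t \<ge> 0 \<Longrightarrow> t_star \<mu> \<le> ereal t \<Longrightarrow> mass (\<mu> t) = 0"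
  using assms unfolding fluid_model_solution_def by blast+

lemma invariant_state_imp_scale:
  assumes cd: "critical_data \<alpha> \<nu>" and \<xi>: "\<xi> \<in> MFc" and inv: "invariant_state \<alpha> \<nu> \<xi>"
  shows "\<xi> = scale_measure (ennreal (mass \<xi>)) (excess_lifetime \<alpha> \<nu>)"
proof -
  let ?\<eta> = "scale_measure (ennreal (mass \<xi>)) (excess_lifetime \<alpha> \<nu>)"
  have MF: "\<xi> \<in> MF" and atom: "measure \<xi> {0} = 0"
    using \<xi> by (simp_all add: MFc_def)
  have MF': "?\<eta> \<in> MF" and atom': "measure ?\<eta> {0} = 0"
    using scale_excess_lifetime_MFc[OF cd mass_nonneg] by (simp_all add: MFc_def)
  have mass': "mass ?\<eta> = mass \<xi>"
    using mass_excess_lifetime[OF cd] by (simp add: mass_scale_measure mass_nonneg)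
  show ?thesis
  \<comment> \<open>A zero mass makes the fluid equation void, but then both measures are
    null.\<close>
  proof (cases "mass \<xi> = 0")
    case True
    then show ?thesis using MF_eqI_mass_zero[OF MF MF'] mass' by simp
  next
    case False
    obtain \<mu> where sol: "fluid_model_solution \<alpha> \<nu> \<mu>" and \<mu>: "\<And>t. t \<ge> 0 \<Longrightarrow> \<mu> t = \<xi>"
      using inv unfolding invariant_state_def the_fluid_model_solution_def by blast
    have t_star: "t_star \<mu> = \<infinity>"
      using False by (intro t_star_infinite) (simp add: \<mu>)
    \<comment> \<open>Any positive time would do: along a constant solution the integral and the
      source are both linear in time, so time 1 already gives the balance.\<close>
    have C3: "pairing g (\<mu> 1) = pairing g (\<mu> 0) - integral {0..1} (\<lambda>s. pairing g' (\<mu> s) / mass (\<mu> s))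
        + \<alpha> * 1 * pairing g \<nu>" if "C1b g g'" "g 0 = 0" "g' 0 = 0" for g g'
      by (rule fluid_model_solutionD(4)[OF sol that]) (simp_all add: t_star)
    show ?thesis
    proof (rule MF_eqI_ramp'[OF MF MF' atom atom'])
      fix k p :: real assume k: "k \<ge> 1" and p: "p \<ge> 0"
      let ?g = "\<lambda>x. ramp k (x - p)" and ?g' = "\<lambda>x. ramp' k (x - p)"
      have g: "C1b ?g ?g'" "?g 0 = 0" "?g' 0 = 0"
        using C1b_ramp[OF k] p by (auto simp: ramp_nonpos)
      have "integral {0..1} (\<lambda>s. pairing ?g' (\<mu> s) / mass (\<mu> s)) =
          integral {0..1::real} (\<lambda>s. pairing ?g' \<xi> / mass \<xi>)"
        by (intro integral_cong) (simp add: \<mu>)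
      then have "pairing ?g' \<xi> = mass \<xi> * (\<alpha> * pairing ?g \<nu>)"
        using C3[OF g] False by (simp add: \<mu> field_simps)
      then show "pairing ?g' \<xi> = pairing ?g' ?\<eta>"
        using pairing_scale_excess_lifetime[OF cd mass_nonneg g(1,2)] by simp
    qed
  qed
qed

section \<open>Uniqueness\<close>

text \<open>Integrating factor: \<open>Y t * exp (- A t)\<close> starts at 0 and its derivative has
  the sign of a (e - Y) <= 0, so that 0 <= e <= Y <= 0.\<close>

lemma Gronwall_zero:
  fixes e a :: "real \<Rightarrow> real"
  assumes T: "0 \<le> T" and cont: "continuous_on {0..T} e" "continuous_on {0..T} a"
    and nonneg: "\<And>t. t \<in> {0..T} \<Longrightarrow> 0 \<le> a t" "\<And>t. t \<in> {0..T} \<Longrightarrow> 0 \<le> e t"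
    and le: "\<And>t. t \<in> {0..T} \<Longrightarrow> e t \<le> integral {0..t} (\<lambda>s. a s * e s)"
  shows "t \<in> {0..T} \<Longrightarrow> e t = 0"
proof -
  define Y where "Y t = integral {0..t} (\<lambda>s. a s * e s)" for t
  define A where "A t = integral {0..t} a" for t
  have dY: "(Y has_real_derivative a t * e t) (at t within {0..T})" if "t \<in> {0..T}" for t
    unfolding Y_def[abs_def] using that cont
    by (intro integral_has_real_derivative continuous_on_mult) auto
  have dA: "(A has_real_derivative a t) (at t within {0..T})" if "t \<in> {0..T}" for t
    unfolding A_def[abs_def] using that cont(2) by (intro integral_has_real_derivative)
  have dW: "((\<lambda>t. Y t * exp (- A t)) has_real_derivative (a t * (e t - Y t)) * exp (- A t)) (at t within {0..T})"
    if "t \<in> {0..T}" for t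
    by (rule derivative_eq_intros dY[OF that] dA[OF that] refl)+ (simp add: algebra_simps)
  assume t: "t \<in> {0..T}"
  have "Y t * exp (- A t) \<le> Y 0 * exp (- A 0)"
  proof (rule DERIV_nonpos_imp_decreasing_open[of 0 t "\<lambda>t. Y t * exp (- A t)"])
    show "\<exists>y. ((\<lambda>t. Y t * exp (- A t)) has_real_derivative y) (at s) \<and> y \<le> 0" if "0 < s" "s < t" for s
    proof (intro exI conjI)
      have s: "s \<in> {0..T}" "s \<in> interior {0..T}" using that t by auto
      show "((\<lambda>t. Y t * exp (- A t)) has_real_derivative (a s * (e s - Y s)) * exp (- A s)) (at s)"
        using dW[OF s(1)] at_within_interior[OF s(2)] by simp
      have "a s * (e s - Y s) \<le> 0"
        using nonneg[OF s(1)] le[OF s(1)] by (intro mult_nonneg_nonpos) (auto simp: Y_def)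
      then show "(a s * (e s - Y s)) * exp (- A s) \<le> 0"
        by (rule mult_nonpos_nonneg) simp
    qed
    show "continuous_on {0..t} (\<lambda>t. Y t * exp (- A t))"
      by (rule continuous_on_subset[OF DERIV_continuous_on[OF dW]]) (use t in auto)
  qed (use t in auto)
  then have "Y t \<le> 0"
    by (simp add: Y_def mult_le_0_iff)
  then show "e t = 0"
    using le[OF t] nonneg(2)[OF t] by (simp add: Y_def)
qed

section \<open>Transport along characteristics\<close>

lemma mass_pos_before_t_star:
  assumes "0 \<le> s" "ereal s < t_star \<mu>"
  shows "mass (\<mu> s) > 0"
proof (rule ccontr)
  assume "\<not> mass (\<mu> s) > 0"
  then have "mass (\<mu> s) = 0" using mass_nonneg[of "\<mu> s"] by linarith
  then show False using t_star_le[of s \<mu>] assms by simp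
qed

lemma continuous_mass:
  assumes sol: "fluid_model_solution \<alpha> \<nu> \<mu>" and "S \<subseteq> {0..}"
  shows "continuous_on S (\<lambda>t. mass (\<mu> t))"
proof (rule continuous_on_subset[OF _ assms(2)])
  have "bounded ((\<lambda>_. 1::real) ` {0::real..})"
    by (rule bounded_subset[of "{1}"]) auto
  then show "continuous_on {0..} (\<lambda>t. mass (\<mu> t))"
    unfolding mass_def
    by (intro continuous_pairing fluid_model_solutionD(1,2)[OF sol]) auto
qed

text \<open>Weak continuity gives continuity in time at a fixed shift, and the Lipschitz bound in
  the shift is uniform near each time since the mass is continuous. Joint continuity serves to
  differentiate along a moving shift.\<close>

lemma continuous_pairing_ramp':
  assumes sol: "fluid_model_solution \<alpha> \<nu> \<mu>" and k: "k \<ge> 1"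
  shows "continuous_on ({0..} \<times> UNIV) (\<lambda>(b, p). pairing (\<lambda>x. ramp' k (x - p)) (\<mu> b))"
proof -
  note MF = fluid_model_solutionD(1)[OF sol]
  let ?P = "\<lambda>b p. pairing (\<lambda>x. ramp' k (x - p)) (\<mu> b)"
  have cP: "continuous_on {0..} (\<lambda>b. ?P b p)" for p
    using C1b_ramp[OF k, of p] unfolding C1b_def
    by (intro continuous_pairing[OF fluid_model_solutionD(2)[OF sol]] MF) auto
  have cm: "continuous_on {0..} (\<lambda>b. mass (\<mu> b))"
    by (rule continuous_mass[OF sol]) simp
  show ?thesis
    unfolding continuous_on_def
  proof (intro ballI)
    fix y :: "real \<times> real" assume "y \<in> {0..} \<times> UNIV"
    then obtain b p where y: "y = (b, p)" and b: "b \<in> {0..}" by auto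
    let ?F = "at (b, p) within {0..} \<times> UNIV"
    have lim_fst: "((\<lambda>z. h (fst z)) \<longlongrightarrow> h b) ?F" if "continuous_on {0..} h" for h :: "real \<Rightarrow> real"
    proof -
      have "continuous_on ({0..} \<times> UNIV) (\<lambda>z. h (fst z :: real))"
        by (rule continuous_on_compose2[OF that]) (auto intro: continuous_intros)
      then show ?thesis
        using b unfolding continuous_on_def by (metis SigmaI UNIV_I fst_conv)
    qed
    have "((\<lambda>z. ?P (fst z) (snd z) - ?P (fst z) p) \<longlongrightarrow> 0) ?F"
    proof (rule Lim_null_comparison)
      show "\<forall>\<^sub>F z in ?F. norm (?P (fst z) (snd z) - ?P (fst z) p) \<le> 6 * k * \<bar>snd z - p\<bar> * mass (\<mu> (fst z))"
        unfolding eventually_at_filter using pairing_ramp'_Lipschitz[OF MF k] by (auto intro!: always_eventually)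
      have "((\<lambda>z. 6 * k * \<bar>snd z - p\<bar> * mass (\<mu> (fst z))) \<longlongrightarrow> 6 * k * \<bar>snd (b, p) - p\<bar> * mass (\<mu> b)) ?F"
        by (intro tendsto_intros lim_fst cm)
      then show "((\<lambda>z. 6 * k * \<bar>snd z - p\<bar> * mass (\<mu> (fst z))) \<longlongrightarrow> 0) ?F"
        by simp
    qed
    then have "((\<lambda>z. ?P (fst z) (snd z) - ?P (fst z) p + ?P (fst z) p) \<longlongrightarrow> 0 + ?P b p) ?F"
      by (intro tendsto_add lim_fst cP)
    then show "((\<lambda>(b, p). ?P b p) \<longlongrightarrow> (case y of (b, p) \<Rightarrow> ?P b p)) (at y within {0..} \<times> UNIV)"
      by (simp add: y case_prod_unfold)
  qed
qed

text \<open>Along the characteristics \<open>p = w - S(t)\<close> with \<open>S' = 1 / mass\<close> the transport term of the fluid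
  equation cancels, and only the source term remains.\<close>

lemma ramp_transport_derivative:
  assumes sol: "fluid_model_solution \<alpha> \<nu> \<mu>" and k: "k \<ge> 1" and T: "ereal T < t_star \<mu>"
    and t: "t \<in> {0..T}"
    and S: "(S has_real_derivative 1 / mass (\<mu> t)) (at t within {0..T})" and p: "w - S t \<ge> 0"
  shows "((\<lambda>t. pairing (\<lambda>x. ramp k (x - (w - S t))) (\<mu> t)) has_real_derivative
    \<alpha> * pairing (\<lambda>x. ramp k (x - (w - S t))) \<nu>) (at t within {0..T})"
proof -
  note MF = fluid_model_solutionD(1)[OF sol]
  define p where "p = w - S t"
  define \<Phi> where "\<Phi> b p = pairing (\<lambda>x. ramp k (x - p)) (\<mu> b)" for b p
  define P where "P b p = pairing (\<lambda>x. ramp' k (x - p)) (\<mu> b)" for b p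
  define N where "N = pairing (\<lambda>x. ramp k (x - p)) \<nu>"
  have p: "p \<ge> 0" using p by (simp add: p_def)
  have g: "C1b (\<lambda>x. ramp k (x - p)) (\<lambda>x. ramp' k (x - p))" "ramp k (0 - p) = 0" "ramp' k (0 - p) = 0"
    using C1b_ramp[OF k] p by (auto simp: ramp_nonpos)
  have before: "ereal s < t_star \<mu>" if "s \<le> T" for s
    using that T by (meson ereal_less_eq(3) le_less_trans)
  have pos: "mass (\<mu> s) > 0" if "s \<in> {0..T}" for s
    using that mass_pos_before_t_star before by auto
  have cP: "continuous_on {0..} (\<lambda>b. P b p)"
    using g(1) unfolding C1b_def P_def
    by (intro continuous_pairing[OF fluid_model_solutionD(2)[OF sol]] MF) auto
  have cm: "continuous_on {0..} (\<lambda>b. mass (\<mu> b))"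
    by (rule continuous_mass[OF sol]) simp
  \<comment> \<open>Before \<open>t_star\<close> the mass is positive, so the integrand of the fluid
    equation is continuous and the equation can be differentiated in time.\<close>
  have cq: "continuous_on {0..T} (\<lambda>s. P s p / mass (\<mu> s))"
  proof (intro continuous_on_divide continuous_on_subset[OF cP] continuous_on_subset[OF cm] ballI)
    show "mass (\<mu> s) \<noteq> 0" if "s \<in> {0..T}" for s
      using pos[OF that] by simp
  qed simp_all
  have eq: "\<Phi> s p = \<Phi> 0 p - integral {0..s} (\<lambda>s. P s p / mass (\<mu> s)) + \<alpha> * s * N" if "s \<in> {0..T}" for s
    unfolding \<Phi>_def P_def N_def using that by (intro fluid_model_solutionD(4)[OF sol g] before) simp_all
  have "((\<lambda>s. \<Phi> 0 p - integral {0..s} (\<lambda>s. P s p / mass (\<mu> s)) + \<alpha> * s * N)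
      has_real_derivative (- (P t p / mass (\<mu> t)) + \<alpha> * N)) (at t within {0..T})"
    by (rule derivative_eq_intros refl integral_has_real_derivative[OF cq t])+ simp
  then have d1: "((\<lambda>s. \<Phi> s p) has_real_derivative (- (P t p / mass (\<mu> t)) + \<alpha> * N)) (at t within {0..T})"
    by (rule has_field_derivative_transform_within[OF _ zero_less_one t]) (rule eq[symmetric])
  \<comment> \<open>Total differentiability at (t, p) follows from the time derivative at this point
    alone together with a shift derivative that is jointly continuous.\<close>
  have "((\<lambda>(b, p). \<Phi> b p) has_derivative
      (\<lambda>(tb, tp). (- (P t p / mass (\<mu> t)) + \<alpha> * N) * tb + blinfun_apply (blinfun_mult_right (- P t p)) tp))
      (at (t, p) within {0..T} \<times> UNIV)"
  proof (rule has_derivative_partialsI)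
    show "((\<lambda>b. \<Phi> b p) has_derivative (*) (- (P t p / mass (\<mu> t)) + \<alpha> * N)) (at t within {0..T})"
      using d1 by (simp add: has_field_derivative_def)
    show "((\<lambda>q. \<Phi> b q) has_derivative blinfun_apply (blinfun_mult_right (- P b q))) (at q within UNIV)"
      if "b \<in> {0..T}" for b q
      using pairing_ramp_derivative[OF MF k, of b q] that
      by (simp add: has_field_derivative_def \<Phi>_def P_def)
    have "continuous_on ({0..T} \<times> UNIV) (\<lambda>z. blinfun_mult_right (- (case z of (b, p) \<Rightarrow> P b p)))"
      unfolding P_def
      by (intro bounded_linear.continuous_on[OF bounded_linear_blinfun_mult_right] continuous_on_minus
          continuous_on_subset[OF continuous_pairing_ramp'[OF sol k]]) auto
    then show "continuous (at (t, p) within {0..T} \<times> UNIV) (\<lambda>(b, p). blinfun_mult_right (- P b p))"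
      using t by (simp add: continuous_on_eq_continuous_within case_prod_unfold)
  qed auto
  \<comment> \<open>Restriction to the graph of the characteristic prepares the chain rule for
    \<open>\<lambda>s. (s, w - S s)\<close>.\<close>
  then have "((\<lambda>(b, p). \<Phi> b p) has_derivative
      (\<lambda>(tb, tp). (- (P t p / mass (\<mu> t)) + \<alpha> * N) * tb + - P t p * tp))
      (at (t, w - S t) within (\<lambda>s. (s, w - S s)) ` {0..T})"
    unfolding p_def blinfun_mult_right.rep_eq by (rule has_derivative_subset) auto
  moreover have "((\<lambda>s. (s, w - S s)) has_derivative (\<lambda>h. (h, - (1 / mass (\<mu> t) * h)))) (at t within {0..T})"
    using S unfolding has_field_derivative_def by (auto intro!: derivative_eq_intros)
  ultimately have "((\<lambda>s. (case (s, w - S s) of (b, p) \<Rightarrow> \<Phi> b p)) has_derivative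
      (\<lambda>h. case (h, - (1 / mass (\<mu> t) * h)) of (tb, tp) \<Rightarrow>
        (- (P t p / mass (\<mu> t)) + \<alpha> * N) * tb + - P t p * tp)) (at t within {0..T})"
    by (rule has_derivative_in_compose[rotated])
  \<comment> \<open>The shift moves with speed \<open>- (1 / mass (\<mu> t))\<close>, so the shift
    derivative contributes \<open>P t p / mass (\<mu> t)\<close> and cancels the transport
    term.\<close>
  then have "((\<lambda>s. \<Phi> s (w - S s)) has_derivative (\<lambda>h. \<alpha> * N * h)) (at t within {0..T})"
    by (simp add: algebra_simps)
  then show ?thesis
    unfolding has_field_derivative_def \<Phi>_def N_def p_def .
qed

text \<open>\<open>\<mu>\<close> is compared with its initial state, tested by a ramp that follows
  the characteristics of \<open>\<mu>\<close> and arrives at shift \<open>p\<close> at time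
  \<open>T\<close>. The gap starts at 0 and changes at rate \<alpha> N (1 - c / z), where z is the
  mass and |N| <= 1. The resulting bound depends on neither \<open>k\<close> nor
  \<open>p\<close>.\<close>

lemma transport_estimate:
  assumes cd: "critical_data \<alpha> \<nu>" and c: "c \<ge> 0"
    and sol: "fluid_model_solution \<alpha> \<nu> \<mu>" and init: "\<mu> 0 = scale_measure (ennreal c) (excess_lifetime \<alpha> \<nu>)"
    and T: "0 \<le> T" "ereal T < t_star \<mu>" and k: "k \<ge> 1" and p: "p \<ge> 0"
  shows "\<bar>pairing (\<lambda>x. ramp k (x - p)) (\<mu> T) - pairing (\<lambda>x. ramp k (x - p)) (\<mu> 0)\<bar>
    \<le> integral {0..T} (\<lambda>s. \<alpha> / mass (\<mu> s) * \<bar>mass (\<mu> s) - c\<bar>)"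
proof -
  note MF = fluid_model_solutionD(1)[OF sol]
  let ?\<xi> = "scale_measure (ennreal c) (excess_lifetime \<alpha> \<nu>)"
  interpret prob_space \<nu> using cd by (simp add: critical_data_def)
  have before: "ereal s < t_star \<mu>" if "s \<le> T" for s
    using that T by (meson ereal_less_eq(3) le_less_trans)
  have pos: "mass (\<mu> s) > 0" if "s \<in> {0..T}" for s
    using that mass_pos_before_t_star before by auto
  have cm: "continuous_on {0..T} (\<lambda>b. mass (\<mu> b))"
    by (rule continuous_mass[OF sol]) simp
  have nz: "mass (\<mu> s) \<noteq> 0" if "s \<in> {0..T}" for s
    using pos[OF that] by simp
  define S where "S t = integral {0..t} (\<lambda>s. 1 / mass (\<mu> s))" for t
  have cinv: "continuous_on {0..T} (\<lambda>s. 1 / mass (\<mu> s))"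
    using nz by (intro continuous_intros cm) auto
  have dS: "(S has_real_derivative 1 / mass (\<mu> t)) (at t within {0..T})" if "t \<in> {0..T}" for t
    unfolding S_def[abs_def] by (rule integral_has_real_derivative[OF cinv that])
  have S_mono: "S t \<le> S T" if "t \<in> {0..T}" for t
    unfolding S_def
  proof (rule integral_subset_le)
    show "\<forall>s\<in>{0..T}. 0 \<le> 1 / mass (\<mu> s)" by (simp add: mass_nonneg)
    show "(\<lambda>s. 1 / mass (\<mu> s)) integrable_on {0..t}"
      using that by (intro integrable_continuous_real continuous_on_subset[OF cinv]) auto
    show "(\<lambda>s. 1 / mass (\<mu> s)) integrable_on {0..T}"
      by (intro integrable_continuous_real cinv)
  qed (use that in auto)
  \<comment> \<open>The characteristic that ends at \<open>p\<close> at time \<open>T\<close>.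
    Monotonicity of \<open>S\<close> keeps it nonnegative, so the ramps stay admissible
    tests.\<close>
  define q where "q t = S T + p - S t" for t
  have q: "q t \<ge> 0" if "t \<in> {0..T}" for t
    using S_mono[OF that] p by (simp add: q_def)
  define N where "N t = pairing (\<lambda>x. ramp k (x - q t)) \<nu>" for t
  define E where "E t = pairing (\<lambda>x. ramp k (x - q t)) (\<mu> t) - pairing (\<lambda>x. ramp k (x - q t)) ?\<xi>" for t
  have dE: "(E has_real_derivative \<alpha> * N t * (1 - c / mass (\<mu> t))) (at t within {0..T})" if t: "t \<in> {0..T}" for t
  proof -
    have d1: "((\<lambda>t. pairing (\<lambda>x. ramp k (x - q t)) (\<mu> t)) has_real_derivative \<alpha> * N t) (at t within {0..T})"
      unfolding q_def N_def using q[OF t]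
      by (intro ramp_transport_derivative[OF sol k T(2) t dS[OF t]]) (simp add: q_def)
    have "?\<xi> \<in> MF" using scale_excess_lifetime_MFc[OF cd c] by (simp add: MFc_def)
    \<comment> \<open>The pairing with the fixed measure changes only through the shift; the excess
      lifetime identity evaluates its \<open>ramp'\<close> pairing as c \<alpha> N.\<close>
    from pairing_ramp_derivative[OF this k, of "q t"]
    have "((\<lambda>p. pairing (\<lambda>x. ramp k (x - p)) ?\<xi>) has_real_derivative - (c * (\<alpha> * N t))) (at (q t))"
      using q[OF t] unfolding N_def
      by (subst (asm) pairing_scale_excess_lifetime[OF cd c C1b_ramp[OF k]]) (simp_all add: ramp_nonpos)
    moreover have "(q has_real_derivative - (1 / mass (\<mu> t))) (at t within {0..T})"
      unfolding q_def[abs_def] by (auto intro!: derivative_eq_intros dS t)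
    ultimately have "((\<lambda>t. pairing (\<lambda>x. ramp k (x - q t)) ?\<xi>) has_real_derivative
        - (c * (\<alpha> * N t)) * - (1 / mass (\<mu> t))) (at t within {0..T})"
      by (rule DERIV_chain2)
    from DERIV_diff[OF d1 this] show ?thesis
      unfolding E_def[abs_def] by (simp add: algebra_simps)
  qed
  have "((\<lambda>t. \<alpha> * N t * (1 - c / mass (\<mu> t))) has_integral (E T - E 0)) {0..T}"
    using dE T(1) by (intro fundamental_theorem_of_calculus)
      (auto simp flip: has_real_derivative_iff_has_vector_derivative)
  moreover have "E 0 = 0" using init by (simp add: E_def)
  ultimately have int: "((\<lambda>t. \<alpha> * N t * (1 - c / mass (\<mu> t))) has_integral E T) {0..T}" by simp
  have "norm (integral {0..T} (\<lambda>t. \<alpha> * N t * (1 - c / mass (\<mu> t))))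
      \<le> integral {0..T} (\<lambda>s. \<alpha> / mass (\<mu> s) * \<bar>mass (\<mu> s) - c\<bar>)"
  proof (rule integral_norm_bound_integral)
    show "(\<lambda>t. \<alpha> * N t * (1 - c / mass (\<mu> t))) integrable_on {0..T}"
      using int by blast
    show "(\<lambda>s. \<alpha> / mass (\<mu> s) * \<bar>mass (\<mu> s) - c\<bar>) integrable_on {0..T}"
      using nz by (intro integrable_continuous_real continuous_intros cm) auto
    fix t assume t: "t \<in> {0..T}"
    have "\<bar>N t\<bar> \<le> 1 * mass \<nu>"
      unfolding N_def using k ramp_range[of k]
      by (intro pairing_bound[OF critical_data_MF[OF cd]] ramp_continuous) auto
    then have N: "\<bar>N t\<bar> \<le> 1" by (simp add: mass_def pairing_def prob_space)
    have "norm (\<alpha> * N t * (1 - c / mass (\<mu> t))) = \<bar>N t\<bar> * (\<alpha> / mass (\<mu> t) * \<bar>mass (\<mu> t) - c\<bar>)"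
      using pos[OF t] critical_data_mean(1)[OF cd]
      by (simp add: abs_mult diff_divide_eq_iff)
    also have "\<dots> \<le> 1 * (\<alpha> / mass (\<mu> t) * \<bar>mass (\<mu> t) - c\<bar>)"
      using pos[OF t] critical_data_mean(1)[OF cd] by (intro mult_right_mono N) auto
    finally show "norm (\<alpha> * N t * (1 - c / mass (\<mu> t))) \<le> \<alpha> / mass (\<mu> t) * \<bar>mass (\<mu> t) - c\<bar>"
      by simp
  qed
  moreover have "E T = pairing (\<lambda>x. ramp k (x - p)) (\<mu> T) - pairing (\<lambda>x. ramp k (x - p)) (\<mu> 0)"
    by (simp add: E_def q_def init)
  ultimately show ?thesis
    using integral_unique[OF int] by simp
qed

text \<open>At shift 0 and as k tends to infinity, \<open>transport_estimate\<close> becomes a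
  Gronwall inequality for |mass - c|, because its right side is independent of \<open>k\<close>.
  Once the mass is c, the same estimate at every shift has right side 0 and identifies the
  measures.\<close>

lemma solution_constant_before_t_star:
  assumes cd: "critical_data \<alpha> \<nu>" and c: "c \<ge> 0"
    and sol: "fluid_model_solution \<alpha> \<nu> \<mu>" and init: "\<mu> 0 = scale_measure (ennreal c) (excess_lifetime \<alpha> \<nu>)"
    and T: "0 \<le> T" "ereal T < t_star \<mu>"
  shows "\<mu> T = \<mu> 0"
proof -
  note MF = fluid_model_solutionD(1)[OF sol] and atom = fluid_model_solutionD(3)[OF sol]
  have before: "ereal s < t_star \<mu>" if "s \<le> T" for s
    using that T by (meson ereal_less_eq(3) le_less_trans)
  have pos: "mass (\<mu> s) > 0" if "s \<in> {0..T}" for s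
    using that mass_pos_before_t_star before by auto
  have nz: "mass (\<mu> s) \<noteq> 0" if "s \<in> {0..T}" for s
    using pos[OF that] by simp
  have cm: "continuous_on {0..T} (\<lambda>b. mass (\<mu> b))"
    by (rule continuous_mass[OF sol]) simp
  have mass0: "mass (\<mu> 0) = c"
    using c mass_excess_lifetime[OF cd] by (simp add: init mass_scale_measure)
  have le: "\<bar>mass (\<mu> t) - c\<bar> \<le> integral {0..t} (\<lambda>s. \<alpha> / mass (\<mu> s) * \<bar>mass (\<mu> s) - c\<bar>)"
    if t: "t \<in> {0..T}" for t
  proof (rule LIMSEQ_le_const2)
    have "(\<lambda>n. \<bar>pairing (\<lambda>x. ramp (real n) (x - 0)) (\<mu> t) - pairing (\<lambda>x. ramp (real n) (x - 0)) (\<mu> 0)\<bar>)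
      \<longlonglongrightarrow> \<bar>pairing (indicator {0<..}) (\<mu> t) - pairing (indicator {0<..}) (\<mu> 0)\<bar>"
      using t by (intro tendsto_intros pairing_ramp_tendsto MF) auto
    then show "(\<lambda>n. \<bar>pairing (\<lambda>x. ramp (real n) (x - 0)) (\<mu> t) - pairing (\<lambda>x. ramp (real n) (x - 0)) (\<mu> 0)\<bar>)
      \<longlonglongrightarrow> \<bar>mass (\<mu> t) - c\<bar>"
      using t mass0 by (simp add: pairing_indicator_eq_mass MF atom)
    show "\<exists>N. \<forall>n\<ge>N. \<bar>pairing (\<lambda>x. ramp (real n) (x - 0)) (\<mu> t) - pairing (\<lambda>x. ramp (real n) (x - 0)) (\<mu> 0)\<bar>
        \<le> integral {0..t} (\<lambda>s. \<alpha> / mass (\<mu> s) * \<bar>mass (\<mu> s) - c\<bar>)"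
      using t before by (intro exI[of _ 1] allI impI transport_estimate[OF cd c sol init]) auto
  qed
  have mass: "\<bar>mass (\<mu> t) - c\<bar> = 0" if "t \<in> {0..T}" for t
    by (rule Gronwall_zero[where a="\<lambda>s. \<alpha> / mass (\<mu> s)", OF T(1) _ _ _ _ le that])
      (use critical_data_mean(1)[OF cd] nz in \<open>auto intro!: continuous_intros cm divide_nonneg_nonneg mass_nonneg\<close>)
  show ?thesis
  proof (rule MF_eqI)
    fix n :: nat and p :: real assume n: "n \<ge> 1" and p: "p \<ge> 0"
    have "integral {0..T} (\<lambda>s. \<alpha> / mass (\<mu> s) * \<bar>mass (\<mu> s) - c\<bar>) = integral {0..T} (\<lambda>s. 0)"
      by (intro integral_cong) (simp add: mass)
    then show "pairing (\<lambda>x. ramp (real n) (x - p)) (\<mu> T) = pairing (\<lambda>x. ramp (real n) (x - p)) (\<mu> 0)"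
      using transport_estimate[OF cd c sol init T, of "real n" p] n p by simp
  qed (use T in \<open>auto intro: MF atom\<close>)
qed

text \<open>It remains to exclude extinction for c > 0: the mass equals c before
  \<open>t_star\<close>, hence by continuity also at a finite \<open>t_star\<close>, where it has to
  be 0. For c = 0 extinction is immediate and only the zero measure is left.\<close>

lemma fluid_model_solution_unique:
  assumes cd: "critical_data \<alpha> \<nu>" and c: "c \<ge> 0"
    and sol: "fluid_model_solution \<alpha> \<nu> \<mu>" and init: "\<mu> 0 = scale_measure (ennreal c) (excess_lifetime \<alpha> \<nu>)"
    and t: "t \<ge> 0"
  shows "\<mu> t = \<mu> 0"
proof -
  note MF = fluid_model_solutionD(1)[OF sol]
  have mass0: "mass (\<mu> 0) = c"
    using c mass_excess_lifetime[OF cd] by (simp add: init mass_scale_measure)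
  show ?thesis
  proof (cases "c = 0")
    case True
    then have "t_star \<mu> \<le> ereal 0"
      using mass0 by (intro t_star_le) auto
    then have "t_star \<mu> \<le> ereal t"
      using t by (meson ereal_less_eq(3) order_trans)
    then have "mass (\<mu> t) = 0"
      by (rule fluid_model_solutionD(5)[OF sol t])
    then show ?thesis
      using mass0 True t by (intro MF_eqI_mass_zero MF) auto
  next
    case False
    have "t_star \<mu> = \<infinity>"
    proof (rule ccontr)
      assume "t_star \<mu> \<noteq> \<infinity>"
      then obtain r where r: "t_star \<mu> = ereal r" "r \<ge> 0"
        using t_star_nonneg[of \<mu>] by (cases "t_star \<mu>") auto
      have zero: "mass (\<mu> r) = 0"
        using r by (intro fluid_model_solutionD(5)[OF sol]) auto
      then have "r > 0"
        using mass0 False r by (cases "r = 0") auto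
      have cm: "continuous_on {0..r} (\<lambda>b. mass (\<mu> b))"
        by (rule continuous_mass[OF sol]) simp
      have "mass (\<mu> r) = c"
      proof (rule continuous_constant_on_closure[of "{0..<r}" "\<lambda>b. mass (\<mu> b)"])
        show "continuous_on (closure {0..<r}) (\<lambda>b. mass (\<mu> b))"
          using cm \<open>r > 0\<close> by simp
        show "mass (\<mu> s) = c" if "s \<in> {0..<r}" for s
          using that r solution_constant_before_t_star[OF cd c sol init, of s] mass0 by simp
        show "r \<in> closure {0..<r}" using \<open>r > 0\<close> by simp
      qed
      then show False using zero False by simp
    qed
    then show ?thesis
      by (intro solution_constant_before_t_star[OF cd c sol init t]) simp
  qed
qed

theorem theorem1p1:
  fixes \<alpha> :: real and \<nu> :: "real measure"
  assumes "critical_data \<alpha> \<nu>"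
  shows "(\<forall>\<xi>\<in>MFc. invariant_state \<alpha> \<nu> \<xi> \<longleftrightarrow>
            (\<exists>c::real. c \<ge> 0 \<and> \<xi> = scale_measure (ennreal c) (excess_lifetime \<alpha> \<nu>)))
       \<and> invariant_manifold \<alpha> \<nu> =
            {scale_measure (ennreal c) (excess_lifetime \<alpha> \<nu>) | c::real. c \<ge> 0}"
proof -
  \<comment> \<open>\<open>invariant_state\<close> includes uniqueness, so the constant path must be
    shown to be the only solution from its initial state.\<close>
  have inv: "invariant_state \<alpha> \<nu> (scale_measure (ennreal c) (excess_lifetime \<alpha> \<nu>))" if "c \<ge> 0" for c
    unfolding invariant_state_def the_fluid_model_solution_def
  proof (intro exI[of _ "\<lambda>_. scale_measure (ennreal c) (excess_lifetime \<alpha> \<nu>)"] conjI allI impI refl)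
    show "fluid_model_solution \<alpha> \<nu> (\<lambda>_. scale_measure (ennreal c) (excess_lifetime \<alpha> \<nu>))"
      by (rule constant_fluid_model_solution[OF assms that])
    show "\<mu> t = scale_measure (ennreal c) (excess_lifetime \<alpha> \<nu>)"
      if "fluid_model_solution \<alpha> \<nu> \<mu> \<and> \<mu> 0 = scale_measure (ennreal c) (excess_lifetime \<alpha> \<nu>)" "0 \<le> t" for \<mu> t
      using fluid_model_solution_unique[OF assms \<open>c \<ge> 0\<close>, of \<mu> t] that by simp
  qed
  \<comment> \<open>The witness for c is \<open>mass \<xi>\<close>.\<close>
  have iff: "invariant_state \<alpha> \<nu> \<xi> \<longleftrightarrow>
      (\<exists>c::real. c \<ge> 0 \<and> \<xi> = scale_measure (ennreal c) (excess_lifetime \<alpha> \<nu>))" if "\<xi> \<in> MFc" for \<xi>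
    using inv invariant_state_imp_scale[OF assms that] mass_nonneg[of \<xi>] by blast
  moreover have "invariant_manifold \<alpha> \<nu> =
      {scale_measure (ennreal c) (excess_lifetime \<alpha> \<nu>) | c::real. c \<ge> 0}"
    unfolding invariant_manifold_def using iff scale_excess_lifetime_MFc[OF assms] by blast
  ultimately show ?thesis by simp
qed

end
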